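(* Let $L$ be a Lelek fan. Then: 1. there is an embedding $f:L\to L$ which is not a homeomorphism of $L$ onto $L$ (i.e. $f(L)\neq L$) such that $f$ admits a retraction; 2. there is an embedding $f:L\to L$ that does not admit a retraction.
   Context: A continuum is a nonempty compact connected metric space. A dendroid is an arcwise connected, hereditarily unicoherent continuum. A point $x$ of a dendroid $X$ is a ramification point if $x$ is the top (the branch point) of some simple triod in $X$. A fan is a dendroid with at most one ramification point; this point, if it exists, is called the top of the fan. For a fan $X$, a point $x$ is an end point of $X$ if $x$ is an end point of every arc in $X$ containing $x$; $E(X)$ denotes the set of end points of $X$. A fan $X$ with top $v$ is smooth if for every $x\in X$ and every sequence $x_n\to x$ in $X$, the arcs from $v$ to $x_n$ converge (in the Hausdorff metric) to the arc from $v$ to $x$. A Lelek fan is a smooth fan $X$ with $\mathrm{Cl}(E(X))=X$. An embedding is a continuous map that is a homeomorphism onto its image. A retraction from a space $X$ onto a subspace $Y$ is a continuous map $r:X\to Y$ with $r(y)=y$ for all $y\in Y$; an embedding $f:X\to Z$ admits a retraction if there is a retraction from $Z$ onto $f(X)$. *)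

theory Defs
  imports "HOL-Analysis.Analysis"
begin

text \<open>Continua are treated as subsets of a metric space (with the subspace metric).\<close>

definition continuum :: "'a::metric_space set \<Rightarrow> bool" where
  "continuum X \<longleftrightarrow> X \<noteq> {} \<and> compact X \<and> connected X"

definition is_arc :: "'a::metric_space set \<Rightarrow> bool" where
  "is_arc A \<longleftrightarrow> (\<exists>g. arc g \<and> path_image g = A)"

definition arc_end_point :: "'a::metric_space set \<Rightarrow> 'a \<Rightarrow> bool" where
  "arc_end_point A x \<longleftrightarrow> (\<exists>g. arc g \<and> path_image g = A \<and> (x = pathstart g \<or> x = pathfinish g))"

definition arc_from_to :: "'a::metric_space set \<Rightarrow> 'a \<Rightarrow> 'a \<Rightarrow> 'a set \<Rightarrow> bool" where
  "arc_from_to X a b A \<longleftrightarrow> A \<subseteq> X \<and>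
     (if a = b then A = {a}
      else (\<exists>g. arc g \<and> path_image g = A \<and> pathstart g = a \<and> pathfinish g = b))"

definition arcwise_connected :: "'a::metric_space set \<Rightarrow> bool" where
  "arcwise_connected X \<longleftrightarrow>
     (\<forall>a\<in>X. \<forall>b\<in>X. a \<noteq> b \<longrightarrow>
        (\<exists>g. arc g \<and> path_image g \<subseteq> X \<and> pathstart g = a \<and> pathfinish g = b))"

definition hereditarily_unicoherent :: "'a::metric_space set \<Rightarrow> bool" where
  "hereditarily_unicoherent X \<longleftrightarrow>
     (\<forall>A B. A \<subseteq> X \<and> B \<subseteq> X \<and> continuum A \<and> continuum B \<longrightarrow> connected (A \<inter> B))"

definition dendroid :: "'a::metric_space set \<Rightarrow> bool" where
  "dendroid X \<longleftrightarrow> continuum X \<and> arcwise_connected X \<and> hereditarily_unicoherent X"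

definition ramification_point :: "'a::metric_space set \<Rightarrow> 'a \<Rightarrow> bool" where
  "ramification_point X x \<longleftrightarrow>
     (\<exists>g1 g2 g3. arc g1 \<and> arc g2 \<and> arc g3 \<and>
        pathstart g1 = x \<and> pathstart g2 = x \<and> pathstart g3 = x \<and>
        path_image g1 \<subseteq> X \<and> path_image g2 \<subseteq> X \<and> path_image g3 \<subseteq> X \<and>
        path_image g1 \<inter> path_image g2 = {x} \<and>
        path_image g1 \<inter> path_image g3 = {x} \<and>
        path_image g2 \<inter> path_image g3 = {x})"

definition fan :: "'a::metric_space set \<Rightarrow> bool" where
  "fan X \<longleftrightarrow> dendroid X \<and> (\<forall>x y. ramification_point X x \<and> ramification_point X y \<longrightarrow> x = y)"

definition end_points :: "'a::metric_space set \<Rightarrow> 'a set" where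
  "end_points X = {x \<in> X. \<forall>A. A \<subseteq> X \<and> is_arc A \<and> x \<in> A \<longrightarrow> arc_end_point A x}"

text \<open>Hausdorff distance (used for nonempty compact sets).\<close>
definition hausdist :: "'a::metric_space set \<Rightarrow> 'a set \<Rightarrow> real" where
  "hausdist A B = max (Sup ((\<lambda>a. infdist a B) ` A)) (Sup ((\<lambda>b. infdist b A) ` B))"

definition smooth_fan :: "'a::metric_space set \<Rightarrow> bool" where
  "smooth_fan X \<longleftrightarrow> fan X \<and>
     (\<exists>v. ramification_point X v \<and>
        (\<forall>x xs A B. x \<in> X \<and> (\<forall>n. xs n \<in> X) \<and> xs \<longlonglongrightarrow> x \<and>
            (\<forall>n. arc_from_to X v (xs n) (A n)) \<and> arc_from_to X v x B
            \<longrightarrow> (\<lambda>n. hausdist (A n) B) \<longlonglongrightarrow> 0))"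

definition Lelek_fan :: "'a::metric_space set \<Rightarrow> bool" where
  "Lelek_fan X \<longleftrightarrow> smooth_fan X \<and> closure (end_points X) = X"

definition embedding_into :: "'a::metric_space set \<Rightarrow> 'b::metric_space set \<Rightarrow> ('a \<Rightarrow> 'b) \<Rightarrow> bool" where
  "embedding_into X Y f \<longleftrightarrow> f ` X \<subseteq> Y \<and> (\<exists>g. homeomorphism X (f ` X) f g)"

end

theory Submission
  imports Defs
begin

text \<open>
  Order the fan by \<open>y \<le> x\<close> iff \<open>y\<close> lies on the arc from the top \<open>v\<close> to \<open>x\<close>. Smoothness makes this order
  closed and yields a continuous, strictly monotone height \<open>h\<close>, so a point of a leg is determined
  by its height.

  Part 2: halve all heights. Legs whose end point is close to the midpoint of a given leg are
  shortened to a quarter of that leg, so a retraction would have to carry their end points through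
  the top, although it is close to the identity near the midpoint.

  Part 1: a sector is a relatively clopen set of legs. Refine a partition of all legs into sectors
  \<open>U\<close> and match them with disjoint sectors \<open>V\<close> inside a proper sector, so that the ratios of
  the maximal heights converge; density of the end points provides \<open>V\<close> with any prescribed maximal
  height. Rescaling heights gives in the limit an embedding \<open>f\<close>. A leg of \<open>V\<close> not met by the
  next generation is rescaled onto the longest leg of the partner \<open>U\<close>; this is possible as no leg of
  \<open>V\<close> is too long, and defines a left inverse \<open>q\<close> of \<open>f\<close>. Then \<open>f \<circ> q\<close> is a retraction.
\<close>

section \<open>Segments of a fan\<close>

text \<open>In part 1 individual legs cannot be matched, since nothing guarantees legs of equal
  height in corresponding places; only the maximal heights of sectors can be prescribed, and only
  approximately. Hence the limit process: every stage flattens a whole sector onto a single longest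
  leg, so no stage is injective on sectors with several legs. Injectivity of \<open>f\<close> is
  obtained only through the left inverse \<open>q\<close>, which is therefore built along with
  \<open>f\<close>; this is why the ratios and their reciprocals must both converge.

  The matching is one-sided. The sectors \<open>U\<close> exhaust all legs, while the sectors
  \<open>V\<close> need not exhaust anything, which leaves the freedom to place each
  \<open>V\<close> around a suitable end point. The price is that \<open>q\<close> must also be
  defined on legs that the matching abandons. Since a sector of a late stage is thin at each height,
  nearness of heights within it already gives nearness of points.

  Part 2 involves no limit of maps. It rests on hereditary unicoherence: a compact connected set
  that misses the top lies on one leg.\<close>

definition segment_path :: "real \<Rightarrow> real \<Rightarrow> (real \<Rightarrow> 'a) \<Rightarrow> real \<Rightarrow> 'a::topological_space" where
  "segment_path a b g x = g ((b - a) * x + a)"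

text \<open>The parameters may also decrease: a reversed piece of an arc serves as the leg of a
  triod that runs back to the top.\<close>

lemma segment_path:
  assumes "arc g" "a \<in> {0..1}" "b \<in> {0..1}" "a \<noteq> b"
  shows arc_segment_path: "arc (segment_path a b g)"
    and pathstart_segment_path: "pathstart (segment_path a b g) = g a"
    and pathfinish_segment_path: "pathfinish (segment_path a b g) = g b"
    and path_image_segment_path: "path_image (segment_path a b g) = g ` closed_segment a b"
proof -
  have img: "(\<lambda>x. (b - a) * x + a) ` {0..1} = closed_segment a b"
    by (auto simp: closed_segment_real_eq)
  have sub: "closed_segment a b \<subseteq> {0..1}"
    using assms by (auto simp: closed_segment_eq_real_ivl split: if_splits)
  have "continuous_on {0..1} (g \<circ> (\<lambda>x. (b - a) * x + a))"
    using assms(1) sub unfolding arc_def path_def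
    by (intro continuous_on_compose continuous_intros) (auto simp: img intro: continuous_on_subset)
  moreover have "inj_on (g \<circ> (\<lambda>x. (b - a) * x + a)) {0..1}"
    using assms(1,4) sub unfolding arc_def by (intro comp_inj_on) (auto simp: img inj_on_def)
  moreover have "g \<circ> (\<lambda>x. (b - a) * x + a) = segment_path a b g" by (auto simp: segment_path_def)
  ultimately show "arc (segment_path a b g)" by (simp add: arc_def path_def)
  show "pathstart (segment_path a b g) = g a" "pathfinish (segment_path a b g) = g b"
    by (simp_all add: pathstart_def pathfinish_def segment_path_def)
  show "path_image (segment_path a b g) = g ` closed_segment a b"
    unfolding path_image_def img[symmetric] by (auto simp: segment_path_def)
qed

lemma continuum_path_image: "arc g \<Longrightarrow> continuum (path_image g)"
  for g :: "real \<Rightarrow> 'a::metric_space"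
  unfolding continuum_def path_image_def arc_def path_def
  by (auto intro: compact_continuous_image connected_continuous_image)

text \<open>Connectedness is moved to the parameter interval, where connected sets are
  intervals.\<close>

lemma arc_preimage_connected:
  fixes g :: "real \<Rightarrow> 'a::metric_space"
  assumes "arc g" "connected C" "C \<subseteq> path_image g"
  shows "connected {t \<in> {0..1}. g t \<in> C}"
proof -
  obtain k where k: "homeomorphism {0..1} (path_image g) g k" using homeomorphism_arc[OF assms(1)] .
  then have "connected (k ` C)"
    using assms homeomorphism_cont2 continuous_on_subset connected_continuous_image by blast
  moreover have "k ` C = {t \<in> {0..1}. g t \<in> C}"
  proof
    show "k ` C \<subseteq> {t \<in> {0..1}. g t \<in> C}"
    proof (intro image_subsetI)
      fix y assume "y \<in> C"
      then have "y \<in> path_image g" using assms(3) by blast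
      then have "k y \<in> {0..1}" "g (k y) = y"
        using homeomorphism_image2[OF k] homeomorphism_apply2[OF k] by blast+
      then show "k y \<in> {t \<in> {0..1}. g t \<in> C}" using \<open>y \<in> C\<close> by simp
    qed
    show "{t \<in> {0..1}. g t \<in> C} \<subseteq> k ` C"
      using homeomorphism_apply1[OF k] by (metis (mono_tags, lifting) imageI mem_Collect_eq subsetI)
  qed
  ultimately show ?thesis by simp
qed

locale fan_at =
  fixes L :: "'a::metric_space set" and v :: 'a
  assumes fan: "fan L" and ram: "ramification_point L v"
begin

lemma dendroid: "continuum L" "arcwise_connected L" "hereditarily_unicoherent L"
  using fan by (auto simp: fan_def dendroid_def)

lemma v_in: "v \<in> L"
  using ram unfolding ramification_point_def by (metis pathstart_in_path_image subsetD)

text \<open>Hereditary unicoherence makes the common part of the two arcs connected. In the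
  parameter interval of either arc it contains 0 and 1, hence everything.\<close>

lemma arc_unique:
  assumes "arc g" "arc k" "path_image g \<subseteq> L" "path_image k \<subseteq> L"
    "pathstart g = pathstart k" "pathfinish g = pathfinish k"
  shows "path_image g = path_image k"
proof -
  have *: "path_image g \<subseteq> path_image k"
    if gk: "arc g" "arc k" "path_image g \<subseteq> L" "path_image k \<subseteq> L"
      "pathstart g = pathstart k" "pathfinish g = pathfinish k" for g k
  proof -
    define I where "I = {t \<in> {0..1}. g t \<in> path_image g \<inter> path_image k}"
    have "connected (path_image g \<inter> path_image k)"
      using dendroid(3) gk continuum_path_image unfolding hereditarily_unicoherent_def by blast
    then have "connected I" unfolding I_def using gk(1) by (intro arc_preimage_connected) auto
    moreover have "0 \<in> I" "1 \<in> I"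
      using gk(5,6) pathstart_in_path_image[of g] pathfinish_in_path_image[of g]
        pathstart_in_path_image[of k] pathfinish_in_path_image[of k]
      by (auto simp: I_def pathstart_def pathfinish_def)
    ultimately have "{0..1} \<subseteq> I" by (rule connected_contains_Icc)
    then show ?thesis unfolding I_def path_image_def by auto
  qed
  show ?thesis using *[of g k] *[of k g] assms by auto
qed

definition A :: "'a \<Rightarrow> 'a set" where "A x = (THE B. arc_from_to L v x B)"

lemma A_arc:
  assumes "arc g" "path_image g \<subseteq> L" "pathstart g = v" "pathfinish g = x"
  shows "A x = path_image g"
proof -
  have "x \<noteq> v" using assms by (metis arc_distinct_ends)
  then show ?thesis
    unfolding A_def arc_from_to_def using assms arc_unique by (intro the_equality) auto
qed

lemma A_v_eq: "A v = {v}"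
  unfolding A_def arc_from_to_def using v_in by (intro the_equality) auto

lemma obtain_arc:
  assumes "x \<in> L" "x \<noteq> v"
  obtains g where "arc g" "path_image g \<subseteq> L" "g 0 = v" "g 1 = x" "A x = g ` {0..1}"
proof -
  obtain g where g: "arc g" "path_image g \<subseteq> L" "pathstart g = v" "pathfinish g = x"
    using dendroid(2) assms v_in unfolding arcwise_connected_def by metis
  then show thesis using that[of g] A_arc[OF g] by (simp add: pathstart_def pathfinish_def path_image_def)
qed

lemma arc_from_to_A: assumes "x \<in> L" shows "arc_from_to L v x (A x)"
proof (cases "x = v")
  case True
  then show ?thesis using v_in by (simp add: arc_from_to_def A_v_eq)
next
  case False
  then obtain g where "arc g" "path_image g \<subseteq> L" "g 0 = v" "g 1 = x" "A x = g ` {0..1}"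
    using obtain_arc assms by metis
  then show ?thesis using False
    unfolding arc_from_to_def by (auto simp: path_image_def pathstart_def pathfinish_def)
qed

lemma A_along:
  assumes g: "arc g" "path_image g \<subseteq> L" "g 0 = v" and t: "t \<in> {0..1}"
  shows "A (g t) = g ` {0..t}"
proof (cases "t = 0")
  case True
  then show ?thesis using g A_v_eq by simp
next
  case False
  have *: "0 \<in> {0..1::real}" "0 \<noteq> t" using False by auto
  have "path_image (segment_path 0 t g) = g ` {0..t}"
    using path_image_segment_path[OF g(1) *(1) t *(2)] t by (simp add: closed_segment_eq_real_ivl)
  moreover from this have "path_image (segment_path 0 t g) \<subseteq> L"
    using g(2) t unfolding path_image_def by force
  ultimately show ?thesis
    using A_arc[OF arc_segment_path[OF g(1) *(1) t *(2)]] g(3)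
      pathstart_segment_path[OF g(1) *(1) t *(2)] pathfinish_segment_path[OF g(1) *(1) t *(2)] by simp
qed

lemma A_props:
  assumes "x \<in> L"
  shows A_subset: "A x \<subseteq> L" and A_self: "x \<in> A x" and A_v: "v \<in> A x"
    and A_trans: "y \<in> A x \<Longrightarrow> A y \<subseteq> A x"
    and A_linear: "\<lbrakk>y \<in> A x; z \<in> A x\<rbrakk> \<Longrightarrow> y \<in> A z \<or> z \<in> A y"
    and A_antisym: "\<lbrakk>y \<in> A x; x \<in> A y\<rbrakk> \<Longrightarrow> y = x"
    and A_connected: "connected (A x)" and A_compact: "compact (A x)"
proof -
  have "A x \<subseteq> L \<and> x \<in> A x \<and> v \<in> A x \<and> (\<forall>y\<in>A x. A y \<subseteq> A x) \<and> (\<forall>y\<in>A x. \<forall>z\<in>A x. y \<in> A z \<or> z \<in> A y)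
    \<and> (\<forall>y\<in>A x. x \<in> A y \<longrightarrow> y = x) \<and> connected (A x) \<and> compact (A x)"
  proof (cases "x = v")
    case True
    then show ?thesis using assms by (simp add: A_v_eq)
  next
    case False
    then obtain g where g: "arc g" "path_image g \<subseteq> L" "g 0 = v" "g 1 = x" "A x = g ` {0..1}"
      using obtain_arc assms by metis
    note along = A_along[OF g(1-3)]
    have inj: "inj_on g {0..1}" using g(1) by (simp add: arc_def)
    have "\<forall>y\<in>A x. A y \<subseteq> A x" unfolding g(5) using along by force
    moreover have "\<forall>y\<in>A x. \<forall>z\<in>A x. y \<in> A z \<or> z \<in> A y"
    proof (intro ballI)
      fix y z assume "y \<in> A x" "z \<in> A x"
      then obtain s t where "s \<in> {0..1}" "t \<in> {0..1}" "y = g s" "z = g t" unfolding g(5) by blast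
      then show "y \<in> A z \<or> z \<in> A y" using along by (cases "s \<le> t") auto
    qed
    moreover have "\<forall>y\<in>A x. x \<in> A y \<longrightarrow> y = x"
    proof (intro ballI impI)
      fix y assume "y \<in> A x" "x \<in> A y"
      then obtain s where s: "s \<in> {0..1}" "y = g s" unfolding g(5) by blast
      then obtain r where r: "r \<in> {0..s}" "x = g r" using \<open>x \<in> A y\<close> along by auto
      then have "r = 1" using inj_onD[OF inj, of r 1] s g(4) by auto
      then show "y = x" using r s by auto
    qed
    moreover have "connected (A x)" "compact (A x)"
      using continuum_path_image[OF g(1)] unfolding g(5) by (auto simp: continuum_def path_image_def)
    ultimately show ?thesis using g by (auto simp: path_image_def intro: image_eqI[of _ g 0] image_eqI[of _ g 1])
  qed
  then show "A x \<subseteq> L" "x \<in> A x" "v \<in> A x" "y \<in> A x \<Longrightarrow> A y \<subseteq> A x"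
    "\<lbrakk>y \<in> A x; z \<in> A x\<rbrakk> \<Longrightarrow> y \<in> A z \<or> z \<in> A y" "\<lbrakk>y \<in> A x; x \<in> A y\<rbrakk> \<Longrightarrow> y = x"
    "connected (A x)" "compact (A x)" by blast+
qed

lemma A_continuum: "x \<in> L \<Longrightarrow> continuum (A x)"
  using A_self A_connected A_compact by (auto simp: continuum_def)

text \<open>If neither point lies below the other, the last common point of the two segments is the
  centre of a triod, hence the top.\<close>

lemma A_fork:
  assumes xy: "x \<in> L" "y \<in> L" and z: "z \<in> A x" "z \<in> A y" "z \<noteq> v"
  shows "x \<in> A y \<or> y \<in> A x"
proof (rule ccontr)
  assume neg: "\<not> ?thesis"
  then have nv: "x \<noteq> v" "y \<noteq> v" using A_v xy by auto
  define C where "C = A x \<inter> A y"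
  have C: "connected C" "compact C"
    using dendroid(3) A_continuum A_subset A_compact xy unfolding hereditarily_unicoherent_def C_def by (auto intro: compact_Int)
  \<comment> \<open>\<open>C\<close> is a continuum through the top, so along the arc to
    \<open>x\<close> it fills a parameter interval \<open>{0..a}\<close>. The point \<open>z\<close>
    forces \<open>0 < a\<close>, and \<open>x \<notin> C\<close> forces
    \<open>a < 1\<close>.\<close>
  have last: "\<exists>g a. arc g \<and> path_image g \<subseteq> L \<and> g 0 = v \<and> g 1 = x \<and> 0 < a \<and> a < 1 \<and> A x = g ` {0..1} \<and> g ` {0..a} = C \<and> A (g a) = C"
    if x: "x \<in> L" "x \<noteq> v" and sub: "C \<subseteq> A x" and xC: "x \<notin> C" and zC: "z \<in> C" "v \<in> C" for x
  proof -
    obtain g where g: "arc g" "path_image g \<subseteq> L" "g 0 = v" "g 1 = x" "A x = g ` {0..1}"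
      using obtain_arc x by metis
    define I where "I = {t \<in> {0..1}. g t \<in> C}"
    have "connected I" unfolding I_def using g sub C by (intro arc_preimage_connected) (auto simp: path_image_def)
    have "closed I"
    proof -
      have "closed ({0..1} \<inter> g -` C)"
        using g(1) C by (intro continuous_closed_preimage) (auto simp: arc_def path_def compact_imp_closed)
      then show ?thesis by (simp add: I_def Int_def vimage_def)
    qed
    then have "compact I" unfolding I_def
      by (metis (no_types, lifting) bounded_closed_interval bounded_subset compact_eq_bounded_closed mem_Collect_eq subsetI)
    moreover have "0 \<in> I" using g zC by (simp add: I_def)
    ultimately obtain a where a: "a \<in> I" "\<And>t. t \<in> I \<Longrightarrow> t \<le> a"
      using compact_attains_sup[of I] by blast
    have "{0..a} \<subseteq> I" using connected_contains_Icc[OF \<open>connected I\<close> \<open>0 \<in> I\<close> a(1)] .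
    then have I: "I = {0..a}" using a by (auto simp: I_def)
    have "C = g ` I" using sub unfolding I_def g(5) by auto
    moreover have "a \<noteq> 1" using a(1) xC g(4) by (auto simp: I_def)
    moreover have "a \<noteq> 0"
    proof
      assume "a = 0"
      then have "C = {v}" using \<open>C = g ` I\<close> I g(3) by simp
      then show False using zC z(3) by simp
    qed
    moreover have "a \<in> {0..1}" using a by (simp add: I_def)
    ultimately show ?thesis using g I A_along[OF g(1-3) \<open>a \<in> {0..1}\<close>]
      by (intro exI[of _ g] exI[of _ a]) auto
  qed
  have zC: "z \<in> C" "v \<in> C" using z A_v xy by (auto simp: C_def)
  obtain g a where g: "arc g" "path_image g \<subseteq> L" "g 0 = v" "g 1 = x" "0 < a" "a < 1" "A x = g ` {0..1}" "g ` {0..a} = C" "A (g a) = C"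
    using last[OF xy(1) nv(1) _ _ zC] neg by (auto simp: C_def)
  obtain k b where k: "arc k" "path_image k \<subseteq> L" "k 0 = v" "k 1 = y" "0 < b" "b < 1" "A y = k ` {0..1}" "k ` {0..b} = C" "A (k b) = C"
    using last[OF xy(2) nv(2) _ _ zC] neg by (auto simp: C_def)
  have ab: "a \<in> {0..1}" "b \<in> {0..1}" "0 \<in> {0..1::real}" "1 \<in> {0..1::real}" using g k by auto
  have wL: "g a \<in> L" "k b \<in> L" using g(2) k(2) ab by (auto simp: path_image_def)
  \<comment> \<open>Both points have the segment \<open>C\<close>, so each lies below the
    other.\<close>
  have w: "g a = k b" using A_antisym[OF wL(1), of "k b"] A_self[OF wL(1)] A_self[OF wL(2)] g(9) k(9) by simp
  have inj: "inj_on g {0..1}" "inj_on k {0..1}" using g k by (auto simp: arc_def)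
  have "ramification_point L (g a)"
    unfolding ramification_point_def
  proof (intro exI conjI)
    let ?g1 = "segment_path a 0 g" and ?g2 = "segment_path a 1 g" and ?g3 = "segment_path b 1 k"
    have ne: "a \<noteq> 0" "a \<noteq> 1" "b \<noteq> 1" using g k by auto
    note s1 = segment_path[OF g(1) ab(1,3) ne(1)] and s2 = segment_path[OF g(1) ab(1,4) ne(2)]
      and s3 = segment_path[OF k(1) ab(2,4) ne(3)]
    show "arc ?g1" "arc ?g2" "arc ?g3" using s1 s2 s3 by auto
    show "pathstart ?g1 = g a" "pathstart ?g2 = g a" "pathstart ?g3 = g a" using s1 s2 s3 w by auto
    have i1: "path_image ?g1 = C" using s1(4) g by (simp add: closed_segment_eq_real_ivl)
    have i2: "path_image ?g2 = g ` {a..1}" using s2(4) g by (simp add: closed_segment_eq_real_ivl)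
    have i3: "path_image ?g3 = k ` {b..1}" using s3(4) k by (simp add: closed_segment_eq_real_ivl)
    show "path_image ?g1 \<subseteq> L" "path_image ?g2 \<subseteq> L" "path_image ?g3 \<subseteq> L"
      unfolding i1 i2 i3 using g k A_subset xy unfolding C_def path_image_def by (blast, force+)
    have Cg: "C \<inter> g ` {a..1} = {g a}"
    proof -
      have "g ` {0..a} \<inter> g ` {a..1} = g ` ({0..a} \<inter> {a..1})"
        using inj_on_image_Int[OF inj(1), of "{0..a}" "{a..1}"] g by auto
      also have "{0..a} \<inter> {a..1} = {a}" using g by auto
      finally show ?thesis using g by simp
    qed
    have Ck: "C \<inter> k ` {b..1} = {g a}"
    proof -
      have "k ` {0..b} \<inter> k ` {b..1} = k ` ({0..b} \<inter> {b..1})"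
        using inj_on_image_Int[OF inj(2), of "{0..b}" "{b..1}"] k by auto
      also have "{0..b} \<inter> {b..1} = {b}" using k by auto
      finally show ?thesis using k w by simp
    qed
    show "path_image ?g1 \<inter> path_image ?g2 = {g a}" "path_image ?g1 \<inter> path_image ?g3 = {g a}"
      unfolding i1 i2 i3 using Cg Ck by auto
    have "g ` {a..1} \<inter> k ` {b..1} \<subseteq> C"
      unfolding C_def g(7) k(7) using ab by (intro Int_mono image_mono) auto
    moreover have "g a \<in> k ` {b..1}" "g a \<in> g ` {a..1}"
      using ab image_eqI[of "g a" k b "{b..1}"] image_eqI[of "g a" g a "{a..1}"] w by simp_all
    ultimately show "path_image ?g2 \<inter> path_image ?g3 = {g a}"
      unfolding i2 i3 using Cg Ck by blast
  qed
  then have "g a = v" using fan ram unfolding fan_def by blast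
  then have "a = 0" using inj_onD[OF inj(1), of a 0] g ab by auto
  then show False using g by simp
qed

text \<open>Two incomparable points have segments that meet only in the top, so \<open>K\<close>
  would close a loop: the continuum \<open>A x \<union> A y\<close> would meet \<open>K\<close> in a
  connected set, although removing the top separates \<open>x\<close> from \<open>y\<close>
  there.\<close>

lemma no_loop:
  assumes K: "K \<subseteq> L" "compact K" "connected K" "v \<notin> K" and xy: "x \<in> K" "y \<in> K"
  shows "x \<in> A y \<or> y \<in> A x"
proof (rule ccontr)
  assume neg: "\<not> ?thesis"
  have L: "x \<in> L" "y \<in> L" using K xy by auto
  then have int: "A x \<inter> A y = {v}" using A_fork[OF L] A_v neg by blast
  have "connected (A x \<union> A y)" using int A_connected L by (intro connected_Un) auto
  then have "continuum (A x \<union> A y)" using A_compact A_self L by (auto simp: continuum_def)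
  moreover have "continuum K" using K xy by (auto simp: continuum_def)
  moreover have "A x \<union> A y \<subseteq> L" using A_subset L by auto
  ultimately have "connected ((A x \<union> A y) \<inter> K)"
    using dendroid(3) K(1) unfolding hereditarily_unicoherent_def by blast
  then have "A x \<inter> ((A x \<union> A y) \<inter> K) = {} \<or> A y \<inter> ((A x \<union> A y) \<inter> K) = {}"
    using int K(4) A_compact L by (intro connected_closedD) (auto simp: compact_imp_closed)
  then show False using A_self L xy by blast
qed

text \<open>Parametrise \<open>A x\<close> by an arc \<open>k\<close> starting at \<open>e\<close>.
  If \<open>x\<close> were different from \<open>e\<close>, both \<open>v\<close> and
  \<open>x\<close> would have positive parameters, and the piece of \<open>k\<close> between them
  would miss \<open>e\<close>; but by uniqueness of arcs this piece is all of
  \<open>A x\<close>.\<close>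

lemma end_point_maximal:
  assumes e: "e \<in> end_points L" "e \<noteq> v" and x: "x \<in> L" "e \<in> A x"
  shows "x = e"
proof (rule ccontr)
  assume ne: "x \<noteq> e"
  then have "x \<noteq> v" using x A_v_eq e(2) by auto
  then obtain g where g: "arc g" "path_image g \<subseteq> L" "g 0 = v" "g 1 = x" "A x = g ` {0..1}"
    using obtain_arc x by metis
  have "is_arc (A x)" using g(1,5) by (auto simp: is_arc_def path_image_def)
  then have "arc_end_point (A x) e" using e(1) x A_subset[OF x(1)] unfolding end_points_def by blast
  then obtain k0 where k0: "arc k0" "path_image k0 = A x" "e = pathstart k0 \<or> e = pathfinish k0"
    unfolding arc_end_point_def by blast
  then obtain k where k: "arc k" "path_image k = A x" "e = k 0"
    using arc_reversepath[OF k0(1)] by (metis path_image_reversepath pathstart_def pathstart_reversepath)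
  obtain s t where st: "s \<in> {0..1}" "v = k s" "t \<in> {0..1}" "x = k t"
    using A_v A_self x k(2) unfolding path_image_def by blast
  have "s \<noteq> 0" "t \<noteq> 0" "s \<noteq> t" using st k(3) e(2) ne \<open>x \<noteq> v\<close> by auto
  note sp = segment_path[OF k(1) st(1,3) \<open>s \<noteq> t\<close>]
  have pos: "0 < s" "0 < t" using st \<open>s \<noteq> 0\<close> \<open>t \<noteq> 0\<close> by auto
  have sub: "closed_segment s t \<subseteq> {0<..1}" using pos st by (auto simp: closed_segment_eq_real_ivl split: if_splits)
  then have "closed_segment s t \<subseteq> {0..1}" by (auto simp: subset_iff)
  then have "k ` closed_segment s t \<subseteq> A x" unfolding k(2)[symmetric] path_image_def by (rule image_mono)
  then have "path_image (segment_path s t k) \<subseteq> L"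
    unfolding sp(4) using A_subset[OF x(1)] by (rule order_trans)
  then have "A x = k ` closed_segment s t" using A_arc[OF sp(1) _ _ sp(3)] sp(2,4) st(2,4) by simp
  then obtain r where r: "r \<in> closed_segment s t" "e = k r" using x(2) by blast
  then have "r \<in> {0<..1}" using sub by blast
  moreover have "inj_on k {0..1}" using k(1) by (simp add: arc_def)
  ultimately show False using r(2) k(3) inj_onD[of k "{0..1}" r 0] by simp
qed

end

section \<open>A height function\<close>

lemma infdist_le_hausdist:
  fixes S T :: "'a::metric_space set"
  assumes "compact S" "compact T"
  shows "a \<in> S \<Longrightarrow> infdist a T \<le> hausdist S T" "b \<in> T \<Longrightarrow> infdist b S \<le> hausdist S T"
proof -
  have "bdd_above ((\<lambda>a. infdist a T) ` S)" "bdd_above ((\<lambda>b. infdist b S) ` T)"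
    using assms by (auto intro!: bounded_imp_bdd_above compact_imp_bounded compact_continuous_image continuous_intros)
  then show "a \<in> S \<Longrightarrow> infdist a T \<le> hausdist S T" "b \<in> T \<Longrightarrow> infdist b S \<le> hausdist S T"
    unfolding hausdist_def using cSup_upper[OF imageI] by (metis max.coboundedI1, metis max.coboundedI2)
qed

lemma compact_infdist_attained:
  fixes T :: "'a::metric_space set"
  assumes "compact T" "T \<noteq> {}"
  obtains t where "t \<in> T" "dist a t \<le> infdist a T"
proof -
  obtain t where "t \<in> T" "\<forall>s\<in>T. dist a t \<le> dist a s"
    using continuous_attains_inf[OF assms, of "dist a"] continuous_on_dist[OF continuous_on_const continuous_on_id] by auto
  then show thesis using that assms(2) by (auto simp: infdist_def intro!: cINF_greatest)
qed

definition peak :: "('a \<Rightarrow> real) \<Rightarrow> 'a set \<Rightarrow> real" where "peak \<phi> S = Sup (\<phi> ` S)"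

text \<open>A tent centred at the first component, with height and radius \<open>1 / (k + 1)\<close>
  for the second component \<open>k\<close>. Slope 1 at every scale keeps all tents
  1-Lipschitz.\<close>

definition bump :: "'a::metric_space \<times> nat \<Rightarrow> 'a \<Rightarrow> real" where
  "bump p z = max 0 (1 / real (Suc (snd p)) - dist (fst p) z)"

lemma bump_bounds: "0 \<le> bump p z" "bump p z \<le> 1"
proof -
  have "1 / real (Suc (snd p)) \<le> 1" by simp
  then show "bump p z \<le> 1" using zero_le_dist[of "fst p" z] unfolding bump_def by linarith
qed (simp add: bump_def)

lemma bump_Lipschitz: "bump p y \<le> bump p z + dist y z"
proof -
  have "dist (fst p) z \<le> dist (fst p) y + dist y z" by (rule dist_triangle)
  then show ?thesis unfolding bump_def using zero_le_dist[of y z] by linarith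
qed

lemma bump_le_peak: "z \<in> S \<Longrightarrow> bump p z \<le> peak (bump p) S"
  unfolding peak_def by (intro cSup_upper imageI bdd_aboveI2[where M = 1] bump_bounds(2))

lemma peak_le: "\<lbrakk>S \<noteq> {}; \<And>z. z \<in> S \<Longrightarrow> \<phi> z \<le> c\<rbrakk> \<Longrightarrow> peak \<phi> S \<le> c"
  unfolding peak_def by (intro cSup_least) auto

lemma peak_bounds: assumes "S \<noteq> {}" shows "0 \<le> peak (bump p) S" "peak (bump p) S \<le> 1"
proof -
  obtain z where "z \<in> S" using assms by blast
  then show "0 \<le> peak (bump p) S" using order_trans[OF bump_bounds(1) bump_le_peak] by blast
  show "peak (bump p) S \<le> 1" using peak_le[OF assms] bump_bounds(2) by blast
qed

lemma peak_mono: "\<lbrakk>S \<noteq> {}; S \<subseteq> T\<rbrakk> \<Longrightarrow> peak (bump p) S \<le> peak (bump p) T"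
  by (rule peak_le) (auto intro: bump_le_peak)

text \<open>Replacing a point of one set by a nearest point of the other costs at most their
  distance. This turns the Hausdorff convergence demanded by smoothness into continuity of real
  functions.\<close>

lemma peak_hausdist:
  fixes S T :: "'a::metric_space set"
  assumes S: "compact S" "S \<noteq> {}" and T: "compact T" "T \<noteq> {}"
  shows "\<bar>peak (bump p) S - peak (bump p) T\<bar> \<le> hausdist S T"
proof -
  have "peak (bump p) S \<le> peak (bump p) T + hausdist S T"
  proof (rule peak_le[OF S(2)])
    fix z assume "z \<in> S"
    obtain t where t: "t \<in> T" "dist z t \<le> infdist z T" using compact_infdist_attained[OF T] .
    then show "bump p z \<le> peak (bump p) T + hausdist S T"
      using bump_Lipschitz[of p z t] bump_le_peak[OF t(1), of p] infdist_le_hausdist(1)[OF S(1) T(1) \<open>z \<in> S\<close>] by linarith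
  qed
  moreover have "peak (bump p) T \<le> peak (bump p) S + hausdist S T"
  proof (rule peak_le[OF T(2)])
    fix z assume "z \<in> T"
    obtain t where t: "t \<in> S" "dist z t \<le> infdist z S" using compact_infdist_attained[OF S] .
    then show "bump p z \<le> peak (bump p) S + hausdist S T"
      using bump_Lipschitz[of p z t] bump_le_peak[OF t(1), of p] infdist_le_hausdist(2)[OF S(1) T(1) \<open>z \<in> T\<close>] by linarith
  qed
  ultimately show ?thesis by linarith
qed

text \<open>Total boundedness gives a finite net at every scale. All nets together are countable, so
  their bumps can be summed with weights.\<close>

lemma countable_bumps:
  fixes L :: "'a::metric_space set"
  assumes "compact L" "L \<noteq> {}"
  obtains j :: "nat \<Rightarrow> 'a \<times> nat"
  where "\<And>x k. x \<in> L \<Longrightarrow> \<exists>n. snd (j n) = k \<and> dist (fst (j n)) x < 1 / real (Suc k)"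
proof -
  have "\<exists>N. finite N \<and> L \<subseteq> (\<Union>p\<in>N. ball p (1 / real (Suc k)))" for k
    using assms(1) unfolding compact_eq_totally_bounded by (auto simp del: of_nat_Suc)
  then obtain N where N: "\<And>k. finite (N k)" "\<And>k. L \<subseteq> (\<Union>p\<in>N k. ball p (1 / real (Suc k)))" by metis
  define J where "J = (\<Union>k. N k \<times> {k})"
  have J: "countable J" unfolding J_def using N(1) by (auto intro: countable_finite)
  show thesis
  proof (rule that[of "from_nat_into J"])
    fix x k assume "x \<in> L"
    then obtain p where p: "p \<in> N k" "dist p x < 1 / real (Suc k)" using N(2)[of k] by (auto simp del: of_nat_Suc)
    then have "(p, k) \<in> J" by (auto simp: J_def)
    then obtain n where "from_nat_into J n = (p, k)" using from_nat_into_surj[OF J] by blast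
    then show "\<exists>n. snd (from_nat_into J n) = k \<and> dist (fst (from_nat_into J n)) x < 1 / real (Suc k)"
      using p by (intro exI[of _ n]) (simp del: of_nat_Suc)
  qed
qed

section \<open>Consequences of smoothness\<close>

locale smooth_fan_at = fan_at +
  assumes smooth: "\<lbrakk>x \<in> L; \<And>n. xs n \<in> L; xs \<longlonglongrightarrow> x; \<And>n. arc_from_to L v (xs n) (Bs n); arc_from_to L v x B\<rbrakk>
    \<Longrightarrow> (\<lambda>n. hausdist (Bs n) B) \<longlonglongrightarrow> 0"
begin

lemma compact_L: "compact L"
  using dendroid(1) by (simp add: continuum_def)

lemma A_ne: "x \<in> L \<Longrightarrow> A x \<noteq> {}"
  using A_self by blast

lemma hausdist_A:
  "\<lbrakk>\<And>n. xs n \<in> L; x \<in> L; xs \<longlonglongrightarrow> x\<rbrakk> \<Longrightarrow> (\<lambda>n. hausdist (A (xs n)) (A x)) \<longlonglongrightarrow> 0"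
  using smooth[of x xs "\<lambda>n. A (xs n)" "A x"] arc_from_to_A by simp

text \<open>A point of \<open>A (xs n)\<close> is within \<open>hausdist (A (xs n)) (A x)\<close> of
  \<open>A x\<close>, and smoothness sends this bound to 0.\<close>

lemma A_closed:
  assumes xs: "\<And>n. xs n \<in> L" and ys: "\<And>n. ys n \<in> A (xs n)" and lim: "xs \<longlonglongrightarrow> x" "ys \<longlonglongrightarrow> y"
  shows "y \<in> A x"
proof -
  have x: "x \<in> L" using closed_sequentially[OF compact_imp_closed[OF compact_L]] xs lim by blast
  have "infdist y (A x) \<le> 0"
  proof (rule LIMSEQ_le)
    show "(\<lambda>n. infdist (ys n) (A x)) \<longlonglongrightarrow> infdist y (A x)" using lim(2) by (rule tendsto_infdist)
    show "(\<lambda>n. hausdist (A (xs n)) (A x)) \<longlonglongrightarrow> 0" using hausdist_A[of xs x] xs x lim by blast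
    show "\<exists>N. \<forall>n\<ge>N. infdist (ys n) (A x) \<le> hausdist (A (xs n)) (A x)"
      using infdist_le_hausdist(1)[OF A_compact[OF xs] A_compact[OF x] ys] by blast
  qed
  then have "infdist y (A x) = 0" using infdist_nonneg[of y "A x"] by linarith
  then show ?thesis
    using in_closed_iff_infdist_zero[OF compact_imp_closed[OF A_compact[OF x]] A_ne[OF x]] by blast
qed

lemma continuous_on_peak: "continuous_on L (\<lambda>x. peak (bump p) (A x))"
  unfolding continuous_on_sequentially
proof (intro allI ballI impI)
  fix xs x assume x: "x \<in> L" and xs: "(\<forall>n. xs n \<in> L) \<and> xs \<longlonglongrightarrow> x"
  have "(\<lambda>n. peak (bump p) (A (xs n))) \<longlonglongrightarrow> peak (bump p) (A x)"
  proof (rule metric_tendsto_imp_tendsto)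
    show "(\<lambda>n. hausdist (A (xs n)) (A x)) \<longlonglongrightarrow> 0" using hausdist_A xs x by blast
    have "dist (peak (bump p) (A (xs n))) (peak (bump p) (A x)) \<le> dist (hausdist (A (xs n)) (A x)) 0" for n
      using peak_hausdist[of "A (xs n)" "A x" p] xs x A_compact A_ne unfolding dist_real_def by simp
    then show "\<forall>\<^sub>F n in sequentially. dist (peak (bump p) (A (xs n))) (peak (bump p) (A x)) \<le> dist (hausdist (A (xs n)) (A x)) 0"
      by simp
  qed
  then show "((\<lambda>x. peak (bump p) (A x)) \<circ> xs) \<longlonglongrightarrow> peak (bump p) (A x)" by (simp add: o_def)
qed

text \<open>The bumps separate any segment from a point outside it, so a weighted sum of their maxima over
  \<open>A x\<close> is strictly monotone in \<open>x\<close>.\<close>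

lemma height_exists:
  obtains h :: "'a \<Rightarrow> real" where "continuous_on L h" "h v = 0" "\<And>x. x \<in> L \<Longrightarrow> h x \<le> 1"
    "\<And>x y. \<lbrakk>x \<in> L; y \<in> A x; y \<noteq> x\<rbrakk> \<Longrightarrow> h y < h x"
proof -
  have "L \<noteq> {}" using v_in by blast
  then obtain j :: "nat \<Rightarrow> 'a \<times> nat"
    where j: "\<And>x k. x \<in> L \<Longrightarrow> \<exists>n. snd (j n) = k \<and> dist (fst (j n)) x < 1 / real (Suc k)"
    using countable_bumps[OF compact_L] by metis
  \<comment> \<open>The weights sum to 1, which yields both the uniform convergence behind
    continuity and the upper bound of the height.\<close>
  define c where "c n x = (1 / 2) ^ Suc n * peak (bump (j n)) (A x)" for n x
  define s where "s x = (\<Sum>n. c n x)" for x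
  have geom: "(\<lambda>n. (1 / 2 :: real) ^ Suc n) sums 1" by (rule power_half_series)
  have cb: "0 \<le> c n x" "c n x \<le> (1 / 2) ^ Suc n" if "x \<in> L" for n x
    using peak_bounds[OF A_ne[OF that], of "j n"] unfolding c_def
    by (simp_all add: mult_left_le del: power_Suc)
  have summ: "summable (\<lambda>n. c n x)" if "x \<in> L" for x
    using cb[OF that] by (intro summable_comparison_test'[OF sums_summable[OF geom], of 0]) auto
  have s0: "0 \<le> s x" if "x \<in> L" for x unfolding s_def using cb[OF that] summ[OF that] by (intro suminf_nonneg) auto
  have s1: "s x \<le> 1" if "x \<in> L" for x
    using suminf_le[OF cb(2)[OF that] summ[OF that] sums_summable[OF geom]] sums_unique[OF geom] unfolding s_def by simp
  have "uniform_limit L (\<lambda>n x. \<Sum>i<n. c i x) s sequentially"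
    unfolding s_def using cb by (intro Weierstrass_m_test[OF _ sums_summable[OF geom]]) auto
  moreover have "continuous_on L (\<lambda>x. \<Sum>i<n. c i x)" for n
    unfolding c_def by (intro continuous_intros continuous_on_peak)
  ultimately have cont: "continuous_on L s"
    by (intro uniform_limit_theorem[where f = "\<lambda>n x. \<Sum>i<n. c i x" and F = sequentially]) auto
  have strict: "s y < s x" if x: "x \<in> L" and y: "y \<in> A x" "y \<noteq> x" for x y
  proof -
    have yL: "y \<in> L" using A_subset x y by blast
    have sub: "A y \<subseteq> A x" using A_trans[OF x y(1)] .
    have "x \<notin> A y" using A_antisym[OF x y(1)] y(2) by blast
    then obtain d where d: "0 < d" "ball x d \<inter> A y = {}"
      using compact_imp_closed[OF A_compact[OF yL]] by (metis Compl_iff disjoint_eq_subset_Compl open_Compl open_contains_ball)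
    \<comment> \<open>\<open>A y\<close> stays at distance at least \<open>d\<close> from
      \<open>x\<close>. A bump of radius below \<open>d / 2\<close>, with centre within that radius
      of \<open>x\<close>, is positive at \<open>x\<close> and vanishes on
      \<open>A y\<close>.\<close>
    obtain k where k: "1 / real (Suc k) < d / 2" using d(1) nat_approx_posE[of "d / 2"] by auto
    obtain n where n: "snd (j n) = k" "dist (fst (j n)) x < 1 / real (Suc k)" using j[OF x] by blast
    have "bump (j n) z = 0" if "z \<in> A y" for z
    proof -
      have "d \<le> dist x z" using d(2) that by (force simp: not_less)
      then show ?thesis using n k dist_triangle[of x z "fst (j n)"] dist_commute[of x "fst (j n)"]
        unfolding bump_def n(1) by linarith
    qed
    then have "peak (bump (j n)) (A y) \<le> 0" using A_ne[OF yL] by (intro peak_le) auto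
    moreover have "0 < bump (j n) x" using n unfolding bump_def by (simp del: of_nat_Suc)
    ultimately have "peak (bump (j n)) (A y) < peak (bump (j n)) (A x)"
      using bump_le_peak[OF A_self[OF x], of "j n"] by linarith
    then have "0 < c n x - c n y" unfolding c_def by simp
    moreover have "0 \<le> c i x - c i y" for i
      using peak_mono[OF A_ne[OF yL] sub, of "j i"] unfolding c_def by simp
    ultimately have "0 < (\<Sum>n. c n x - c n y)"
      using summ[OF x] summ[OF yL] by (intro suminf_pos2[of _ n] summable_diff)
    then show ?thesis using suminf_diff[OF summ[OF x] summ[OF yL]] unfolding s_def by simp
  qed
  show thesis
  proof (rule that[of "\<lambda>x. s x - s v"])
    show "continuous_on L (\<lambda>x. s x - s v)" by (intro continuous_intros cont)
    show "s x - s v \<le> 1" if "x \<in> L" for x using s1[OF that] s0[OF v_in] by linarith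
  qed (use strict in auto)
qed

end

section \<open>Fans with a height function\<close>

text \<open>Used for \<open>f\<close> and for its left inverse. The explicit error is kept because
  the two limits are later compared through their approximations.\<close>

lemma geometric_uniform_limit:
  fixes g :: "nat \<Rightarrow> 'b::topological_space \<Rightarrow> 'a::metric_space"
  assumes "compact K" and cont: "\<And>n. continuous_on D (g n)" and gK: "\<And>n x. x \<in> D \<Longrightarrow> g n x \<in> K"
    and step: "\<And>n x. x \<in> D \<Longrightarrow> dist (g (Suc n) x) (g n x) \<le> C / 2 ^ n"
  obtains G where "continuous_on D G" "\<And>x. x \<in> D \<Longrightarrow> G x \<in> K"
    "\<And>n x. x \<in> D \<Longrightarrow> dist (g n x) (G x) \<le> 2 * C / 2 ^ n"
proof -
  \<comment> \<open>The bound is the exact sum of the \<open>k\<close> steps starting at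
    \<open>n\<close>, which lets the induction close.\<close>
  have tel: "dist (g (n + k) x) (g n x) \<le> 2 * C / 2 ^ n - 2 * C / 2 ^ (n + k)" if "x \<in> D" for n k x
  proof (induction k)
    case (Suc k)
    have "dist (g (n + Suc k) x) (g n x) \<le> dist (g (Suc (n + k)) x) (g (n + k) x) + dist (g (n + k) x) (g n x)"
      by (simp add: dist_triangle)
    also have "\<dots> \<le> C / 2 ^ (n + k) + (2 * C / 2 ^ n - 2 * C / 2 ^ (n + k))"
      using step[OF that, of "n + k"] Suc by linarith
    also have "\<dots> = 2 * C / 2 ^ n - 2 * C / 2 ^ (n + Suc k)" by (simp add: field_simps)
    finally show ?case .
  qed simp
  have C: "0 \<le> C" if "x \<in> D" for x
    using order_trans[OF zero_le_dist step[OF that, of 0]] by simp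
  have bnd: "dist (g m x) (g n x) \<le> 2 * C / 2 ^ n" if "x \<in> D" "n \<le> m" for x m n
    using tel[OF that(1), of n "m - n"] that C[OF that(1)]
    by (smt (verit) divide_nonneg_pos le_add_diff_inverse zero_less_power)
  have "\<exists>y\<in>K. (\<lambda>n. g n x) \<longlonglongrightarrow> y" if x: "x \<in> D" for x
  proof -
    have "Cauchy (\<lambda>n. g n x)"
    proof (rule metric_CauchyI)
      fix e :: real assume "0 < e"
      have "(\<lambda>n. 4 * C / 2 ^ n) \<longlonglongrightarrow> 0" by (rule LIMSEQ_divide_realpow_zero) simp
      then obtain N where N: "4 * C / 2 ^ N < e"
        using \<open>0 < e\<close> by (metis eventually_sequentially order_refl order_tendstoD(2))
      have "dist (g m x) (g n x) < e" if "N \<le> m" "N \<le> n" for m n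
        using bnd[OF x that(1)] bnd[OF x that(2)] dist_triangle2[of "g m x" "g n x" "g N x"] N by simp
      then show "\<exists>M. \<forall>m\<ge>M. \<forall>n\<ge>M. dist (g m x) (g n x) < e" by blast
    qed
    moreover have "\<forall>n. g n x \<in> K" using gK[OF x] by simp
    ultimately show ?thesis
      using compact_imp_complete[OF \<open>compact K\<close>, unfolded complete_def, rule_format, of "\<lambda>n. g n x"] by blast
  qed
  then obtain G where G: "\<And>x. x \<in> D \<Longrightarrow> G x \<in> K \<and> (\<lambda>n. g n x) \<longlonglongrightarrow> G x" by metis
  have lim: "dist (g n x) (G x) \<le> 2 * C / 2 ^ n" if x: "x \<in> D" for n x
  proof (rule Lim_bounded)
    show "(\<lambda>m. dist (g n x) (g m x)) \<longlonglongrightarrow> dist (g n x) (G x)" using G[OF x] by (intro tendsto_intros) auto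
    show "\<forall>m\<ge>n. dist (g n x) (g m x) \<le> 2 * C / 2 ^ n" using bnd[OF x] by (metis dist_commute)
  qed
  have "uniform_limit D g G sequentially"
  proof (rule uniform_limitI)
    fix e :: real assume "0 < e"
    have "(\<lambda>n. 2 * C / 2 ^ n) \<longlonglongrightarrow> 0" by (rule LIMSEQ_divide_realpow_zero) simp
    then have "\<forall>\<^sub>F n in sequentially. 2 * C / 2 ^ n < e" using \<open>0 < e\<close> by (rule order_tendstoD(2))
    then show "\<forall>\<^sub>F n in sequentially. \<forall>x\<in>D. dist (g n x) (G x) < e"
    proof eventually_elim
      case (elim n)
      then show ?case using lim[of _ n] by (meson order_le_less_trans)
    qed
  qed
  then have "continuous_on D G" using cont by (intro uniform_limit_theorem[where f = g and F = sequentially]) auto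
  then show thesis using that G lim by blast
qed

text \<open>Each choice excludes only finitely many values. It will supply distinct end points even
  when the same height is prescribed several times.\<close>

lemma injective_choice:
  assumes "finite I" "\<And>i. i \<in> I \<Longrightarrow> infinite (E i)"
  shows "\<exists>f. inj_on f I \<and> (\<forall>i\<in>I. f i \<in> E i)"
  using assms
proof (induction rule: finite_induct)
  case (insert i I)
  then obtain f where f: "inj_on f I" "\<forall>i\<in>I. f i \<in> E i" by auto
  have "infinite (E i - f ` I)" using insert by simp
  then obtain y where "y \<in> E i" "y \<notin> f ` I" by (metis DiffE all_not_in_conv finite.emptyI)
  with f insert.hyps show ?case
    by (intro exI[of _ "f(i := y)"]) (auto simp: inj_on_def)
qed simp

text \<open>Both quotients are continuous at \<open>m = \<alpha> * \<mu> > 0\<close>. Here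
  \<open>\<mu>\<close> and \<open>m\<close> stand for the maximal heights of two sectors to be
  matched, and \<open>\<alpha>\<close> for the ratio to be approximated.\<close>

lemma rate_continuity:
  fixes \<alpha> \<mu> \<delta> :: real
  assumes "0 < \<alpha>" "0 < \<mu>" "0 < \<delta>"
  shows "\<exists>\<zeta>>0. \<forall>m. \<bar>m - \<alpha> * \<mu>\<bar> < \<zeta> \<longrightarrow> \<bar>m / \<mu> - \<alpha>\<bar> \<le> \<delta> \<and> \<bar>\<mu> / m - 1 / \<alpha>\<bar> \<le> \<delta>"
proof -
  have id: "((\<lambda>m. m) \<longlongrightarrow> \<alpha> * \<mu>) (nhds (\<alpha> * \<mu>))" by (simp add: filterlim_ident)
  have "((\<lambda>m. m / \<mu>) \<longlongrightarrow> \<alpha> * \<mu> / \<mu>) (nhds (\<alpha> * \<mu>))" "((\<lambda>m. \<mu> / m) \<longlongrightarrow> \<mu> / (\<alpha> * \<mu>)) (nhds (\<alpha> * \<mu>))"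
    using assms by (intro tendsto_divide id tendsto_const; simp)+
  moreover have "\<alpha> * \<mu> / \<mu> = \<alpha>" "\<mu> / (\<alpha> * \<mu>) = 1 / \<alpha>" using assms by auto
  ultimately have "\<forall>\<^sub>F m in nhds (\<alpha> * \<mu>). dist (m / \<mu>) \<alpha> < \<delta> \<and> dist (\<mu> / m) (1 / \<alpha>) < \<delta>"
    using assms by (simp add: tendstoD eventually_conj)
  then obtain \<zeta> where "0 < \<zeta>" "\<And>m. dist m (\<alpha> * \<mu>) < \<zeta> \<Longrightarrow> dist (m / \<mu>) \<alpha> < \<delta> \<and> dist (\<mu> / m) (1 / \<alpha>) < \<delta>"
    unfolding eventually_nhds_metric by blast
  then show ?thesis by (intro exI[of _ \<zeta>]) (force simp: dist_real_def)
qed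

text \<open>All that the two constructions take from a Lelek fan: a closed order, a height, the
  absence of loops, and density of the maximal points. Parametrised arcs and the Hausdorff distance
  no longer occur.\<close>

locale radial_fan =
  fixes L :: "'a::metric_space set" and v :: 'a and A :: "'a \<Rightarrow> 'a set" and h :: "'a \<Rightarrow> real"
  assumes compact_L: "compact L" and v_in: "v \<in> L" and nontrivial: "\<exists>x\<in>L. x \<noteq> v"
    and A_subset: "x \<in> L \<Longrightarrow> A x \<subseteq> L"
    and A_self: "x \<in> L \<Longrightarrow> x \<in> A x"
    and A_v: "x \<in> L \<Longrightarrow> v \<in> A x"
    and A_trans: "\<lbrakk>x \<in> L; y \<in> A x\<rbrakk> \<Longrightarrow> A y \<subseteq> A x"
    and A_connected: "x \<in> L \<Longrightarrow> connected (A x)"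
    and A_linear: "\<lbrakk>x \<in> L; y \<in> A x; z \<in> A x\<rbrakk> \<Longrightarrow> y \<in> A z \<or> z \<in> A y"
    and A_fork: "\<lbrakk>x \<in> L; y \<in> L; z \<in> A x; z \<in> A y; z \<noteq> v\<rbrakk> \<Longrightarrow> x \<in> A y \<or> y \<in> A x"
    and A_closed: "\<lbrakk>\<And>n. xs n \<in> L; \<And>n. ys n \<in> A (xs n); xs \<longlonglongrightarrow> x; ys \<longlonglongrightarrow> y\<rbrakk> \<Longrightarrow> y \<in> A x"
    and h_cont: "continuous_on L h" and h_v: "h v = 0" and h_le: "x \<in> L \<Longrightarrow> h x \<le> 1"
    and h_strict: "\<lbrakk>x \<in> L; y \<in> A x; y \<noteq> x\<rbrakk> \<Longrightarrow> h y < h x"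
    and no_loop: "\<lbrakk>K \<subseteq> L; compact K; connected K; v \<notin> K; x \<in> K; y \<in> K\<rbrakk> \<Longrightarrow> x \<in> A y \<or> y \<in> A x"
    and ends_dense: "\<lbrakk>x \<in> L; x \<noteq> v; 0 < \<epsilon>\<rbrakk> \<Longrightarrow>
      \<exists>e\<in>L. e \<noteq> v \<and> dist e x < \<epsilon> \<and> (\<forall>y\<in>L. e \<in> A y \<longrightarrow> y = e)"
begin

section \<open>Height as a coordinate on segments\<close>

lemma A_mem_L: "\<lbrakk>x \<in> L; y \<in> A x\<rbrakk> \<Longrightarrow> y \<in> L"
  using A_subset by blast

lemma h_mono: "\<lbrakk>x \<in> L; y \<in> A x\<rbrakk> \<Longrightarrow> h y \<le> h x"
  using h_strict by force

lemma h_pos: "\<lbrakk>x \<in> L; x \<noteq> v\<rbrakk> \<Longrightarrow> 0 < h x"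
  using h_strict[of x v] A_v h_v by auto

lemma h_nonneg: "x \<in> L \<Longrightarrow> 0 \<le> h x"
  using h_pos h_v by (cases "x = v") (auto intro: less_imp_le)

lemma h_eq_0: "x \<in> L \<Longrightarrow> h x = 0 \<longleftrightarrow> x = v"
  using h_pos h_v by force

lemma A_inj: "\<lbrakk>x \<in> L; y \<in> A x; z \<in> A x; h y = h z\<rbrakk> \<Longrightarrow> y = z"
  using A_linear[of x y z] h_strict[of y z] h_strict[of z y] A_mem_L by fastforce

lemma compact_A: assumes "x \<in> L" shows "compact (A x)"
proof -
  have "closed (A x)"
    unfolding closed_sequential_limits
    using A_closed[of "\<lambda>_. x" _ x] assms by auto
  with compact_L A_subset[OF assms] show ?thesis
    by (metis compact_Int_closed inf.absorb_iff2)
qed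

lemma h_image_A: assumes "x \<in> L" shows "h ` A x = {0..h x}"
proof
  show "h ` A x \<subseteq> {0..h x}"
    using assms A_mem_L h_nonneg h_mono by fastforce
  have "connected (h ` A x)"
    by (meson A_connected A_subset assms connected_continuous_image continuous_on_subset h_cont)
  moreover have "0 \<in> h ` A x" "h x \<in> h ` A x"
    using A_v A_self assms h_v by force+
  ultimately show "{0..h x} \<subseteq> h ` A x"
    by (meson connected_contains_Icc)
qed

text \<open>Meaningful for \<open>0 \<le> s \<le> h x\<close>: there such a point exists because
  \<open>A x\<close> is connected, and it is unique because \<open>h\<close> is injective on
  \<open>A x\<close>.\<close>

definition pt :: "'a \<Rightarrow> real \<Rightarrow> 'a" where
  "pt x s = (THE y. y \<in> A x \<and> h y = s)"

lemma pt_h: assumes "x \<in> L" "y \<in> A x" shows "pt x (h y) = y"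
  unfolding pt_def using assms A_inj by (intro the_equality) auto

lemma pt_0: "x \<in> L \<Longrightarrow> pt x 0 = v"
  using pt_h[OF _ A_v] h_v by auto

lemma pt:
  assumes "x \<in> L" "0 \<le> s" "s \<le> h x"
  shows pt_in_A: "pt x s \<in> A x" and h_pt: "h (pt x s) = s" and pt_in_L: "pt x s \<in> L"
proof -
  have "s \<in> h ` A x" using assms h_image_A by auto
  then show "pt x s \<in> A x" "h (pt x s) = s" "pt x s \<in> L" using pt_h assms A_mem_L by auto
qed

lemma continuous_on_pt: assumes "x \<in> L" shows "continuous_on {0..h x} (pt x)"
proof -
  have "continuous_on (h ` A x) (pt x)"
    using assms compact_A pt_h continuous_on_subset[OF h_cont A_subset]
    by (intro continuous_on_inv) auto
  then show ?thesis using assms h_image_A by simp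
qed

text \<open>For \<open>s > 0\<close> these pieces avoid the top while still joining any two of their
  points. They are the connected sets against which sectors and clopen partitions are
  tested.\<close>

lemma A_connected_upper:
  assumes "x \<in> L" "0 \<le> s" shows "connected {y \<in> A x. s \<le> h y}"
    and "compact {y \<in> A x. s \<le> h y}"
proof -
  have "{y \<in> A x. s \<le> h y} = pt x ` {s..h x}"
  proof
    show "{y \<in> A x. s \<le> h y} \<subseteq> pt x ` {s..h x}"
      using pt_h h_mono assms by (force intro!: image_eqI)
    show "pt x ` {s..h x} \<subseteq> {y \<in> A x. s \<le> h y}"
      using pt assms by force
  qed
  moreover have "continuous_on {s..h x} (pt x)"
    using continuous_on_pt[OF assms(1)] continuous_on_subset assms(2) by fastforce
  ultimately show "connected {y \<in> A x. s \<le> h y}" "compact {y \<in> A x. s \<le> h y}"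
    by (auto intro: connected_continuous_image compact_continuous_image)
qed

text \<open>Away from the top, comparability means lying on a common leg. At \<open>y = v\<close>
  this fails, since the top is below every point.\<close>

lemma comparable_trans:
  assumes "x \<in> L" "y \<in> L" "z \<in> L" "y \<noteq> v" "x \<in> A y \<or> y \<in> A x" "y \<in> A z \<or> z \<in> A y"
  shows "x \<in> A z \<or> z \<in> A x"
  using assms A_linear[of y x z] A_fork[of x z y] A_trans[of x y] A_trans[of z y] A_mem_L by blast

section \<open>Uniform estimates by compactness\<close>

lemma convergent_subseq:
  fixes xs ys :: "nat \<Rightarrow> 'a"
  assumes "\<And>n. xs n \<in> L" "\<And>n. ys n \<in> L"
  obtains x y r where "x \<in> L" "y \<in> L" "strict_mono r" "(\<lambda>n. xs (r n)) \<longlonglongrightarrow> x" "(\<lambda>n. ys (r n)) \<longlonglongrightarrow> y"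
proof -
  have "seq_compact (L \<times> L)" using compact_L by (simp add: compact_Times compact_imp_seq_compact)
  moreover have "\<forall>n. (xs n, ys n) \<in> L \<times> L" using assms by simp
  ultimately obtain p r where "p \<in> L \<times> L" "strict_mono r" "((\<lambda>n. (xs n, ys n)) \<circ> r) \<longlonglongrightarrow> p"
    using seq_compactE[of "L \<times> L" "\<lambda>n. (xs n, ys n)"] by metis
  then show thesis
    using that[of "fst p" "snd p" r] tendsto_fst[of "(\<lambda>n. (xs n, ys n)) \<circ> r"] tendsto_snd[of "(\<lambda>n. (xs n, ys n)) \<circ> r"]
    by (simp add: o_def mem_Times_iff)
qed

lemma h_seq: "\<lbrakk>\<And>n. xs n \<in> L; xs \<longlonglongrightarrow> x\<rbrakk> \<Longrightarrow> (\<lambda>n. h (xs n)) \<longlonglongrightarrow> h x"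
  using h_cont compact_L
  by (metis (mono_tags, lifting) closed_sequentially compact_imp_closed continuous_on_tendsto_compose eventually_sequentiallyI)

text \<open>Counterexamples would converge to some \<open>y \<in> A x\<close> with
  \<open>y \<noteq> x\<close> but \<open>h x \<le> h y\<close>. So differences of height control
  distances along segments, uniformly over the fan.\<close>

lemma seg_short:
  assumes "0 < \<epsilon>"
  obtains \<delta> where "0 < \<delta>" "\<And>x y. \<lbrakk>x \<in> L; y \<in> A x; h x - h y \<le> \<delta>\<rbrakk> \<Longrightarrow> dist x y < \<epsilon>"
proof (rule ccontr)
  assume "\<not> thesis"
  with that have "\<exists>x y. x \<in> L \<and> y \<in> A x \<and> h x - h y \<le> \<delta> \<and> \<not> dist x y < \<epsilon>" if "0 < \<delta>" for \<delta>
    using that by meson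
  then have "\<exists>x y. x \<in> L \<and> y \<in> A x \<and> h x - h y \<le> inverse (Suc n) \<and> \<not> dist x y < \<epsilon>" for n by simp
  then obtain xs ys where s: "\<And>n. xs n \<in> L" "\<And>n. ys n \<in> A (xs n)"
      "\<And>n. h (xs n) - h (ys n) \<le> inverse (Suc n)" "\<And>n. \<not> dist (xs n) (ys n) < \<epsilon>"
    by metis
  then obtain x y r where l: "x \<in> L" "y \<in> L" "strict_mono r" "(\<lambda>n. xs (r n)) \<longlonglongrightarrow> x" "(\<lambda>n. ys (r n)) \<longlonglongrightarrow> y"
    using convergent_subseq[of xs ys] A_mem_L[OF s(1) s(2)] by metis
  have "y \<in> A x" using A_closed[of "\<lambda>n. xs (r n)" "\<lambda>n. ys (r n)"] s l by auto
  have "(\<lambda>n. h (xs (r n)) - h (ys (r n))) \<longlonglongrightarrow> h x - h y"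
    using s(1,2) l A_mem_L[OF s(1) s(2)] by (intro tendsto_diff h_seq)
  moreover have "(\<lambda>n. inverse (real (Suc (r n)))) \<longlonglongrightarrow> 0"
    using LIMSEQ_subseq_LIMSEQ[OF LIMSEQ_inverse_real_of_nat l(3)] by (simp add: o_def)
  ultimately have "h x - h y \<le> 0"
    using s(3) by (intro LIMSEQ_le[of _ "h x - h y"]) auto
  then have "x = y" using h_strict[OF l(1) \<open>y \<in> A x\<close>] by force
  have "(\<lambda>n. dist (xs (r n)) (ys (r n))) \<longlonglongrightarrow> dist x y" using l by (intro tendsto_dist)
  then have "\<epsilon> \<le> dist x y" using s(4) by (intro LIMSEQ_le_const) (auto simp: not_less)
  with \<open>x = y\<close> assms show False by simp
qed

lemma near_v:
  assumes "0 < \<epsilon>" obtains s where "0 < s" "\<And>x. \<lbrakk>x \<in> L; h x \<le> s\<rbrakk> \<Longrightarrow> dist x v < \<epsilon>"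
proof -
  obtain \<delta> where "0 < \<delta>" "\<And>x y. \<lbrakk>x \<in> L; y \<in> A x; h x - h y \<le> \<delta>\<rbrakk> \<Longrightarrow> dist x y < \<epsilon>"
    using seg_short[OF assms] by metis
  then show thesis using that[of \<delta>] A_v h_v by force
qed

definition maximal :: "'a \<Rightarrow> bool" where
  "maximal e \<longleftrightarrow> e \<in> L \<and> e \<noteq> v \<and> (\<forall>y\<in>L. e \<in> A y \<longrightarrow> y = e)"

subsection \<open>Halving every segment\<close>

definition half :: "'a \<Rightarrow> 'a" where "half x = pt x (h x / 2)"

lemma half:
  assumes "x \<in> L" shows "half x \<in> A x" "h (half x) = h x / 2" "half x \<in> L"
  using assms pt[of x "h x / 2"] h_nonneg[of x] by (auto simp: half_def)

text \<open>By compactness only cluster points matter. Such a point lies on \<open>A x\<close>, as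
  the order is closed, and has height \<open>h x / 2\<close>, so it is
  \<open>half x\<close>.\<close>

lemma half_seq:
  assumes xs: "\<And>n. xs n \<in> L" "xs \<longlonglongrightarrow> x" shows "(\<lambda>n. half (xs n)) \<longlonglongrightarrow> half x"
proof (rule ccontr)
  have x: "x \<in> L" using xs compact_L closed_sequentially compact_imp_closed by blast
  assume "\<not> ?thesis"
  then obtain \<epsilon> where "0 < \<epsilon>" and "\<forall>N. \<exists>n\<ge>N. \<epsilon> \<le> dist (half (xs n)) (half x)"
    unfolding lim_sequentially by (meson not_less)
  then have "infinite {n. \<epsilon> \<le> dist (half (xs n)) (half x)}"
    by (simp add: infinite_nat_iff_unbounded_le)
  then obtain r :: "nat \<Rightarrow> nat" where r: "strict_mono r" "\<And>n. r n \<in> {n. \<epsilon> \<le> dist (half (xs n)) (half x)}"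
    using infinite_enumerate by metis
  obtain x' y k where l: "x' \<in> L" "y \<in> L" "strict_mono k" "(\<lambda>n. xs (r (k n))) \<longlonglongrightarrow> x'" "(\<lambda>n. half (xs (r (k n)))) \<longlonglongrightarrow> y"
    using convergent_subseq[of "\<lambda>n. xs (r n)" "\<lambda>n. half (xs (r n))"] xs(1) half(3) by metis
  have "x' = x"
    using LIMSEQ_unique[OF l(4)] LIMSEQ_subseq_LIMSEQ[OF LIMSEQ_subseq_LIMSEQ[OF xs(2) r(1)] l(3)]
    by (simp add: o_def)
  have "y \<in> A x'" using A_closed[of "\<lambda>n. xs (r (k n))" "\<lambda>n. half (xs (r (k n)))"] xs half l by auto
  moreover have "h y = h x' / 2"
  proof -
    have "(\<lambda>n. h (half (xs (r (k n))))) \<longlonglongrightarrow> h y" using xs half l by (intro h_seq) auto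
    moreover have "(\<lambda>n. h (xs (r (k n))) / 2) \<longlonglongrightarrow> h x' / 2"
      using xs l by (intro tendsto_divide h_seq tendsto_const) auto
    ultimately show ?thesis using xs(1) half(2) LIMSEQ_unique[of _ "h y" "h x' / 2"] by simp
  qed
  ultimately have "y = half x" using \<open>x' = x\<close> half x A_inj by metis
  moreover have "\<epsilon> \<le> dist y (half x)"
  proof (rule LIMSEQ_le_const)
    show "(\<lambda>n. dist (half (xs (r (k n)))) (half x)) \<longlonglongrightarrow> dist y (half x)"
      using l by (intro tendsto_intros)
  qed (use r in auto)
  ultimately show False using \<open>0 < \<epsilon>\<close> by simp
qed

lemma continuous_on_half: "continuous_on L half"
  unfolding continuous_on_sequentially by (auto simp: o_def intro: half_seq)

lemma half_eq_v: "x \<in> L \<Longrightarrow> half x = v \<longleftrightarrow> x = v"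
  using half h_eq_0 by (metis divide_eq_0_iff h_v zero_neq_numeral)

lemma inj_on_half: "inj_on half L"
proof
  fix x y assume xy: "x \<in> L" "y \<in> L" "half x = half y"
  show "x = y"
  proof (cases "half x = v")
    case True then show ?thesis using xy half_eq_v by metis
  next
    case False
    then have "x \<in> A y \<or> y \<in> A x" using A_fork[of x y "half x"] xy half by metis
    moreover have "h x = h y" using xy half(2) by (metis divide_cancel_right zero_neq_numeral)
    ultimately show ?thesis using h_strict xy by force
  qed
qed

lemma half_no_retraction: "\<not> (\<exists>r. retraction L (half ` L) r)"
proof
  assume "\<exists>r. retraction L (half ` L) r"
  then obtain r where "retraction L (half ` L) r" by blast
  then have r: "continuous_on L r" "r ` L \<subseteq> half ` L" "\<And>x. x \<in> half ` L \<Longrightarrow> r x = x"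
    by (simp_all only: retraction_def image_subset_iff_funcset)
  have r_half: "\<exists>w\<in>L. r x = half w" if "x \<in> L" for x
    using r(2) that by (meson imageE imageI subsetD)
  have rL: "r x \<in> L" if "x \<in> L" for x using r_half[OF that] half(3) by metis
  have r_seq: "(\<lambda>n. r (xs n)) \<longlonglongrightarrow> r x" if "\<And>n. xs n \<in> L" "xs \<longlonglongrightarrow> x" "x \<in> L" for xs x
    using continuous_on_tendsto_compose[OF r(1) that(2,3)] that(1) by simp
  obtain z where z: "z \<in> L" "z \<noteq> v" using nontrivial by blast
  define p where "p = half z"
  have p: "p \<in> L" "p \<noteq> v" "p \<in> half ` L" using z half half_eq_v by (auto simp: p_def)
  \<comment> \<open>The retraction fixes \<open>p\<close>. Hence an end point \<open>e\<close> near
    \<open>p\<close> is sent to a height close to \<open>h p\<close>, about twice that of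
    \<open>half e\<close>.\<close>
  have "continuous_on L (\<lambda>x. h (r x) - h x / 2)"
    using rL by (intro continuous_intros h_cont continuous_on_compose2[OF h_cont r(1)]) auto
  moreover have "0 < h (r p) - h p / 2" using h_pos[OF p(1,2)] r(3)[OF p(3)] by simp
  ultimately obtain \<eta> where \<eta>: "0 < \<eta>"
      "\<And>e. \<lbrakk>e \<in> L; dist e p < \<eta>\<rbrakk> \<Longrightarrow> dist (h (r e) - h e / 2) (h (r p) - h p / 2) < h (r p) - h p / 2"
    using p(1) unfolding continuous_on_iff by metis
  have "\<exists>e. maximal e \<and> dist e p < min \<eta> (inverse (Suc n))" for n
    using ends_dense[OF p(1,2), of "min \<eta> (inverse (Suc n))"] \<eta>(1) by (auto simp: maximal_def)
  then obtain es where es: "\<And>n. maximal (es n)" "\<And>n. dist (es n) p < min \<eta> (inverse (Suc n))" by metis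
  have esL: "es n \<in> L" "es n \<noteq> v" for n using es by (auto simp: maximal_def)
  have es_lim: "es \<longlonglongrightarrow> p"
  proof (rule metric_tendsto_imp_tendsto[OF LIMSEQ_inverse_real_of_nat], intro always_eventually allI)
    show "dist (es n) p \<le> dist (inverse (real (Suc n))) 0" for n
      using es(2)[of n] by simp
  qed
  \<comment> \<open>The upper half of the segment to \<open>es n\<close> joins
    \<open>half (es n)\<close>, which the retraction fixes, to \<open>es n\<close>.\<close>
  define K where "K n = {y \<in> A (es n). h (es n) / 2 \<le> h y}" for n
  have KL: "K n \<subseteq> L" for n using A_subset esL by (auto simp: K_def)
  \<comment> \<open>Otherwise points sent to the top accumulate at a point of \<open>A p\<close> of
    height at least \<open>h p / 2\<close>. As \<open>A p\<close> lies in the image of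
    \<open>half\<close>, that point is fixed, yet it is not the top.\<close>
  have "\<exists>n. \<forall>x \<in> K n. r x \<noteq> v"
  proof (rule ccontr)
    assume "\<not> ?thesis"
    then obtain xs where xs: "\<And>n. xs n \<in> K n" "\<And>n. r (xs n) = v" by metis
    obtain q x k where l: "q \<in> L" "x \<in> L" "strict_mono k" "(\<lambda>n. es (k n)) \<longlonglongrightarrow> q" "(\<lambda>n. xs (k n)) \<longlonglongrightarrow> x"
      using convergent_subseq[of es xs] esL(1) subsetD[OF KL xs(1)] by metis
    have "q = p" using LIMSEQ_unique[OF l(4)] LIMSEQ_subseq_LIMSEQ[OF es_lim l(3)] by (simp add: o_def)
    have "x \<in> A p" using A_closed[of "\<lambda>n. es (k n)" "\<lambda>n. xs (k n)" q x] esL xs l \<open>q = p\<close> by (auto simp: K_def)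
    have xhalf: "x \<in> half ` L"
    proof (rule image_eqI)
      \<comment> \<open>Twice the height of \<open>x\<close> is still available on
        \<open>A z\<close>, because \<open>x\<close> lies below the midpoint \<open>p\<close> of
        that segment.\<close>
      define y where "y = pt z (2 * h x)"
      have y: "y \<in> A z" "h y = 2 * h x" "y \<in> L"
        using pt[of z "2 * h x"] h_mono[OF p(1) \<open>x \<in> A p\<close>] z half(2)[OF z(1)] h_nonneg[OF l(2)]
        by (simp_all add: p_def y_def)
      have "x \<in> A z" using A_trans[of z p] half(1)[OF z(1)] z \<open>x \<in> A p\<close> by (auto simp: p_def)
      moreover have "half y \<in> A z" using A_trans[OF z(1) y(1)] half(1)[OF y(3)] by blast
      ultimately show "x = half y" using A_inj[OF z(1)] half(2)[OF y(3)] y(2) by simp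
      show "y \<in> L" by fact
    qed
    have "(\<lambda>n. r (xs (k n))) \<longlonglongrightarrow> r x" using l xs KL by (intro r_seq) auto
    then have "r x = v" using xs by (simp add: LIMSEQ_const_iff)
    then have "x = v" using r(3) xhalf by simp
    have "h p / 2 \<le> h x"
    proof (rule LIMSEQ_le)
      show "(\<lambda>n. h (es (k n)) / 2) \<longlonglongrightarrow> h p / 2"
        using esL l \<open>q = p\<close> by (intro tendsto_divide h_seq tendsto_const) auto
      show "(\<lambda>n. h (xs (k n))) \<longlonglongrightarrow> h x" using l xs KL by (intro h_seq) auto
    qed (use xs in \<open>auto simp: K_def\<close>)
    then show False using \<open>x = v\<close> h_v h_pos p by fastforce
  qed
  then obtain n where n: "\<And>x. x \<in> K n \<Longrightarrow> r x \<noteq> v" by blast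
  have Kn: "es n \<in> K n" "half (es n) \<in> K n"
    using A_self half[of "es n"] esL h_nonneg[of "es n"] by (auto simp: K_def)
  have "compact (K n)" "connected (K n)"
    using A_connected_upper[of "es n" "h (es n) / 2"] esL(1)[of n] h_nonneg[of "es n"] unfolding K_def by simp_all
  then have "compact (r ` K n)" "connected (r ` K n)"
    using continuous_on_subset[OF r(1) KL] by (simp_all add: compact_continuous_image connected_continuous_image)
  moreover have "r ` K n \<subseteq> L" using KL rL by (meson image_subsetI subsetD)
  moreover have "v \<notin> r ` K n" using n by (metis imageE)
  moreover have "r (es n) \<in> r ` K n" using Kn by simp
  moreover have "half (es n) \<in> r ` K n" using Kn(2) r(3)[OF imageI[OF esL(1)]] by (metis imageI)
  \<comment> \<open>The image of \<open>K n\<close> is connected, avoids the top and contains both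
    points, so they lie on one leg.\<close>
  ultimately have cmp: "r (es n) \<in> A (half (es n)) \<or> half (es n) \<in> A (r (es n))"
    using no_loop[of "r ` K n"] by simp
  have lt: "h (half (es n)) < h (r (es n))"
    using \<eta>(2)[OF esL(1)[of n]] es(2)[of n] half(2)[OF esL(1)[of n]] by (auto simp: dist_real_def abs_less_iff)
  have nv: "half (es n) \<noteq> v" using esL(2)[of n] half_eq_v[OF esL(1)[of n]] by simp
  obtain w where w: "w \<in> L" "r (es n) = half w" using r_half[OF esL(1)[of n]] by auto
  \<comment> \<open>This puts \<open>w\<close> on the leg that ends at \<open>es n\<close>. So
    \<open>w\<close> is not above \<open>es n\<close>, and halving preserves that, against
    \<open>lt\<close>.\<close>
  have "half (es n) \<in> A (half w)"
    using cmp lt h_mono[OF half(3)[OF esL(1)[of n]]] w by force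
  then have "half (es n) \<in> A w" using half(1)[OF w(1)] A_trans[OF w(1)] by blast
  then have "es n \<in> A w \<or> w \<in> A (es n)"
    using A_fork[OF esL(1)[of n] w(1) half(1)[OF esL(1)] _ nv] by simp
  then have "w \<in> A (es n)" using es(1)[of n] w A_self[OF w(1)] by (auto simp: maximal_def)
  then have "h (half w) \<le> h (half (es n))"
    using h_mono[OF esL(1)[of n], of w] half(2)[OF esL(1)[of n]] half(2)[OF w(1)] by simp
  then show False using lt w by simp
qed

subsection \<open>Sectors\<close>

text \<open>The two closedness conditions say that \<open>U\<close> is relatively clopen in \<open>L - {v}\<close>;
  such a set is automatically a union of legs.\<close>

definition sector :: "'a set \<Rightarrow> bool" where
  "sector U \<longleftrightarrow> U \<subseteq> L - {v} \<and> closed (insert v U) \<and> closed (L - U)"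

lemma closed_L: "closed L"
  using compact_L by (rule compact_imp_closed)

lemma sector_subset: "sector U \<Longrightarrow> x \<in> U \<Longrightarrow> x \<in> L" "sector U \<Longrightarrow> x \<in> U \<Longrightarrow> x \<noteq> v"
  unfolding sector_def by auto

lemma sector_full: "sector (L - {v})"
proof -
  have "insert v (L - {v}) = L" "L - (L - {v}) = {v}" using v_in by auto
  then show ?thesis using closed_L unfolding sector_def by simp
qed

lemma sector_Int: assumes "sector U" "sector W" shows "sector (U \<inter> W)"
proof -
  have "insert v (U \<inter> W) = insert v U \<inter> insert v W" "L - (U \<inter> W) = (L - U) \<union> (L - W)"
    by auto
  moreover have "closed (insert v U \<inter> insert v W)" "closed ((L - U) \<union> (L - W))"
    using assms unfolding sector_def by blast+
  ultimately show ?thesis using assms unfolding sector_def by auto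
qed

lemma sector_compl: assumes "sector U" shows "sector (L - {v} - U)"
proof -
  have "insert v (L - {v} - U) = L - U" "L - (L - {v} - U) = insert v U"
    using assms v_in unfolding sector_def by auto
  with assms show ?thesis unfolding sector_def by auto
qed

lemma sector_Diff: assumes "sector U" "sector W" shows "sector (U - W)"
proof -
  have "U - W = U \<inter> (L - {v} - W)" using assms unfolding sector_def by auto
  then show ?thesis using assms by (simp add: sector_Int sector_compl)
qed

lemma sector_Union:
  assumes "finite \<C>" "\<And>U. U \<in> \<C> \<Longrightarrow> sector U" shows "sector (\<Union>\<C>)"
  using assms
proof (induction rule: finite_induct)
  case empty
  then show ?case using sector_Diff[OF sector_full sector_full] by simp
next
  case (insert U \<C>)
  have "sector (\<Union>\<C>)" "sector U" using insert by auto
  moreover have "\<Union>(insert U \<C>) = L - {v} - (L - {v} - U - \<Union>\<C>)"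
    using \<open>sector (\<Union>\<C>)\<close> \<open>sector U\<close> unfolding sector_def by auto
  ultimately show ?case by (simp only: sector_compl sector_Diff)
qed

text \<open>A connected piece of a segment that avoids the top cannot meet both closed sets
  \<open>insert v U\<close> and \<open>L - U\<close>.\<close>

lemma sector_saturated:
  assumes U: "sector U" "x \<in> U" and y: "y \<in> L" "y \<noteq> v" and xy: "x \<in> A y \<or> y \<in> A x"
  shows "y \<in> U"
proof -
  have x: "x \<in> L" "x \<noteq> v" using sector_subset U by auto
  obtain z where z: "z \<in> L" "x \<in> A z" "y \<in> A z" using xy x y A_self by blast
  define s where "s = min (h x) (h y)"
  have s: "0 < s" using h_pos x y by (simp add: s_def)
  define K where "K = {w \<in> A z. s \<le> h w}"
  have "connected K" using A_connected_upper z s by (simp add: K_def)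
  moreover have "v \<notin> K" using h_v s by (simp add: K_def)
  moreover have "K \<subseteq> L" using A_subset z by (auto simp: K_def)
  ultimately have "insert v U \<inter> K = {} \<or> (L - U) \<inter> K = {}"
    using U(1) unfolding sector_def by (intro connected_closedD) auto
  moreover have "x \<in> K" "y \<in> K" using z by (auto simp: K_def s_def)
  ultimately show ?thesis using U y by auto
qed

section \<open>Longest legs and thin sectors\<close>

definition tip :: "'a set \<Rightarrow> 'a" where
  "tip U = (SOME e. e \<in> U \<and> (\<forall>x\<in>U. h x \<le> h e))"

abbreviation M :: "'a set \<Rightarrow> real" where "M U \<equiv> h (tip U)"

lemma tip:
  assumes "sector U" "U \<noteq> {}"
  \<comment> \<open>The maximum is attained because \<open>insert v U\<close> is compact, and it is
    not attained at the top, whose height is 0.\<close>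
  shows tip_in: "tip U \<in> U" and M_ge: "x \<in> U \<Longrightarrow> h x \<le> M U" and M_pos: "0 < M U" and tip_in_L: "tip U \<in> L"
proof -
  have sub: "insert v U \<subseteq> L" using assms v_in unfolding sector_def by auto
  then have "compact (insert v U)"
    using assms compact_L unfolding sector_def by (metis compact_Int_closed inf.absorb_iff2)
  moreover have "continuous_on (insert v U) h" using h_cont sub continuous_on_subset by blast
  ultimately obtain e where e: "e \<in> insert v U" "\<And>x. x \<in> insert v U \<Longrightarrow> h x \<le> h e"
    using continuous_attains_sup[of "insert v U" h] by auto
  obtain u where u: "u \<in> U" using assms by auto
  have "0 < h u" using h_pos sector_subset assms u by blast
  then have "e \<in> U" using e u h_v by force
  then have "\<exists>e. e \<in> U \<and> (\<forall>x\<in>U. h x \<le> h e)" using e by blast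
  then have t: "tip U \<in> U \<and> (\<forall>x\<in>U. h x \<le> M U)"
    unfolding tip_def by (rule someI_ex)
  then show "tip U \<in> U" "x \<in> U \<Longrightarrow> h x \<le> M U" by auto
  show "tip U \<in> L" using sector_subset(1)[OF assms(1)] t by blast
  show "0 < M U" using u \<open>0 < h u\<close> t by force
qed

lemma pt_tip:
  assumes U: "sector U" "U \<noteq> {}" and s: "0 < s" "s \<le> M U"
  shows "pt (tip U) s \<in> U" "h (pt (tip U) s) = s"
proof -
  have p: "pt (tip U) s \<in> A (tip U)" "h (pt (tip U) s) = s" "pt (tip U) s \<in> L"
    using pt[of "tip U" s] tip_in_L U s by auto
  then show "h (pt (tip U) s) = s" by simp
  have "pt (tip U) s \<noteq> v" using p s h_v by auto
  then show "pt (tip U) s \<in> U" using sector_saturated[of U "tip U"] p tip_in U by blast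
qed

text \<open>Only points of equal height are compared, so a sector of long legs can be small although
  its diameter is large.\<close>

definition small :: "real \<Rightarrow> 'a set \<Rightarrow> bool" where
  "small \<epsilon> U \<longleftrightarrow> (\<forall>x\<in>U. \<forall>y\<in>U. h x = h y \<longrightarrow> dist x y \<le> \<epsilon>)"

lemma small_subset: "\<lbrakk>small \<epsilon> U; W \<subseteq> U\<rbrakk> \<Longrightarrow> small \<epsilon> W"
  unfolding small_def by blast

text \<open>Slide the higher point down its own leg to the height of the lower one; it stays in the
  sector and moves by less than \<open>\<epsilon>\<close>. The number \<open>\<delta>\<close> does
  not depend on the sector, so it can be fixed before sectors are chosen.\<close>

lemma small_dist:
  assumes "0 < \<epsilon>"
  obtains \<delta> where "0 < \<delta>"
    "\<And>U x y. \<lbrakk>sector U; small \<epsilon> U; x \<in> U; y \<in> U; \<bar>h x - h y\<bar> \<le> \<delta>\<rbrakk> \<Longrightarrow> dist x y \<le> 2 * \<epsilon>"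
proof -
  obtain \<delta> where \<delta>: "0 < \<delta>" "\<And>x y. \<lbrakk>x \<in> L; y \<in> A x; h x - h y \<le> \<delta>\<rbrakk> \<Longrightarrow> dist x y < \<epsilon>"
    using seg_short[OF assms] by metis
  have *: "dist x y \<le> 2 * \<epsilon>"
    if U: "sector U" "small \<epsilon> U" and xy: "x \<in> U" "y \<in> U" "h x \<le> h y" "h y - h x \<le> \<delta>" for U x y
  proof -
    have L: "x \<in> L" "x \<noteq> v" "y \<in> L" using sector_subset U xy by auto
    define z where "z = pt y (h x)"
    have z: "z \<in> A y" "h z = h x" "z \<in> L"
      using pt[of y "h x"] L xy h_nonneg by (auto simp: z_def)
    have "z \<noteq> v" using z L h_eq_0 by metis
    then have "z \<in> U" using sector_saturated[of U y z] U xy z by blast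
    then have "dist x z \<le> \<epsilon>" using U xy z unfolding small_def by simp
    moreover have "dist y z < \<epsilon>" using \<delta>(2)[of y z] L z xy by simp
    ultimately show ?thesis using dist_triangle2[of x y z] by linarith
  qed
  show thesis
  proof (rule that[OF \<delta>(1)])
    fix U x y assume "sector U" "small \<epsilon> U" "x \<in> U" "y \<in> U" "\<bar>h x - h y\<bar> \<le> \<delta>"
    then show "dist x y \<le> 2 * \<epsilon>"
      using *[of U x y] *[of U y x] by (cases "h x \<le> h y") (auto simp: dist_commute)
  qed
qed

subsection \<open>Separating segments by sectors\<close>

text \<open>By \<open>no_loop\<close> connected subsets of the level set are chains, so
  \<open>P\<close> and \<open>Q\<close> share no component. In a compact Hausdorff space components
  are quasi-components, so points of \<open>P\<close> and \<open>Q\<close> are separated by clopen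
  sets; compactness extends this to \<open>P\<close> and \<open>Q\<close>.\<close>

lemma level_separation:
  assumes s: "0 < s" and PQ: "compact P" "compact Q" "P \<subseteq> {x \<in> L. s \<le> h x}" "Q \<subseteq> {x \<in> L. s \<le> h x}"
    and nc: "\<And>p q. \<lbrakk>p \<in> P; q \<in> Q\<rbrakk> \<Longrightarrow> p \<notin> A q \<and> q \<notin> A p"
  shows "\<exists>T1 T2. closed T1 \<and> closed T2 \<and> T1 \<union> T2 = {x \<in> L. s \<le> h x} \<and> T1 \<inter> T2 = {} \<and> P \<subseteq> T1 \<and> Q \<subseteq> T2"
proof -
  define K where "K = {x \<in> L. s \<le> h x}"
  define X where "X = top_of_set K"
  have "closed K"
    using continuous_closed_preimage[OF h_cont closed_L, of "{s..}"] by (simp add: K_def vimage_def Int_def)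
  then have "compact K" using compact_L by (metis (no_types, lifting) K_def compact_Int_closed inf.absorb_iff2 mem_Collect_eq subsetI)
  have X: "compact_space X" "Hausdorff_space X"
    using \<open>compact K\<close> by (auto simp: X_def compact_space_subtopology Hausdorff_space_subtopology)
  have cp: "compactin X P" "compactin X Q" using PQ by (auto simp: X_def K_def compactin_subtopology)
  have "separated_between X {p} {q}" if "p \<in> P" "q \<in> Q" for p q
  proof -
    have pq: "p \<in> K" "q \<in> K" using PQ that by (auto simp: K_def)
    have "\<not> quasi_component_of X p q"
    proof
      assume "quasi_component_of X p q"
      then have "connected_component_of X p q"
        using quasi_eq_connected_component_of[of X p] X by simp
      then obtain C where C: "connectedin X C" "p \<in> C" "q \<in> C"
        unfolding connected_component_of_def by blast
      have C': "connected C" "C \<subseteq> K" using C by (auto simp: X_def connectedin_subtopology)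
      then have cl: "closure C \<subseteq> K" using \<open>closed K\<close> by (simp add: closure_minimal)
      moreover have "compact (closure C)"
        using cl \<open>compact K\<close> by (metis compact_Int_closed closed_closure inf.absorb_iff2)
      moreover have "connected (closure C)" using C' by (simp add: connected_imp_connected_closure)
      moreover have "v \<notin> K" using s h_v by (simp add: K_def)
      moreover have "K \<subseteq> L" by (auto simp: K_def)
      moreover have "p \<in> closure C" "q \<in> closure C" using C closure_subset by auto
      ultimately have "p \<in> A q \<or> q \<in> A p" using no_loop[of "closure C" p q] by (meson order_trans subsetD)
      then show False using nc that by blast
    qed
    then show ?thesis using pq by (simp add: separated_between_singletons X_def)
  qed
  then have "separated_between X P Q"
    using cp PQ by (auto simp: separated_between_pointwise_left separated_between_pointwise_right X_def K_def)
  then obtain T1 T2 where T: "closedin X T1" "closedin X T2" "T1 \<union> T2 = topspace X" "disjnt T1 T2" "P \<subseteq> T1" "Q \<subseteq> T2"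
    unfolding separated_between_alt by blast
  show ?thesis
  proof (intro exI conjI)
    show "closed T1" "closed T2" using T \<open>closed K\<close> by (auto simp: X_def dest: closedin_closed_trans)
    show "T1 \<union> T2 = {x \<in> L. s \<le> h x}" using T by (simp add: X_def K_def)
    show "T1 \<inter> T2 = {}" using T by (simp add: disjnt_def)
  qed (use T in auto)
qed

text \<open>A clopen partition is available only above a positive height. It is extended downwards
  through the levels \<open>s / 2 ^ n\<close>, each partition enlarging the previous one, and the
  union is clopen away from the top.\<close>

lemma sector_separation:
  assumes PQ: "compact P" "compact Q" "P \<subseteq> L - {v}" "Q \<subseteq> L - {v}"
    and nc: "\<And>p q. \<lbrakk>p \<in> P; q \<in> Q\<rbrakk> \<Longrightarrow> p \<notin> A q \<and> q \<notin> A p"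
  obtains U where "sector U" "P \<subseteq> U" "Q \<inter> U = {}"
proof -
  have "\<exists>s>0. \<forall>x \<in> P \<union> Q. s \<le> h x"
  proof (cases "P \<union> Q = {}")
    case True then show ?thesis by (intro exI[of _ 1]) auto
  next
    case False
    have "compact (P \<union> Q)" using PQ by auto
    moreover have "continuous_on (P \<union> Q) h" using h_cont PQ by (meson Diff_subset Un_least continuous_on_subset order_trans)
    ultimately obtain x where "x \<in> P \<union> Q" "\<And>y. y \<in> P \<union> Q \<Longrightarrow> h x \<le> h y"
      using continuous_attains_inf[of "P \<union> Q" h] False by blast
    moreover have "0 < h x" using h_pos PQ \<open>x \<in> P \<union> Q\<close> by auto
    ultimately show ?thesis by blast
  qed
  then obtain s where s: "0 < s" "\<And>x. x \<in> P \<union> Q \<Longrightarrow> s \<le> h x" by blast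
  define K where "K n = {x \<in> L. s / 2 ^ n \<le> h x}" for n :: nat
  define good where "good n T \<longleftrightarrow> closed (fst T) \<and> closed (snd T) \<and> fst T \<union> snd T = K n \<and> fst T \<inter> snd T = {}
    \<and> P \<subseteq> fst T \<and> Q \<subseteq> snd T" for n and T :: "'a set \<times> 'a set"
  have s2: "0 < s / 2 ^ n" for n :: nat using s by simp
  have "\<exists>T. good 0 T"
  proof -
    have "P \<subseteq> K 0" "Q \<subseteq> K 0" using PQ s by (auto simp: K_def)
    then have "\<exists>T1 T2. closed T1 \<and> closed T2 \<and> T1 \<union> T2 = K 0 \<and> T1 \<inter> T2 = {} \<and> P \<subseteq> T1 \<and> Q \<subseteq> T2"
      unfolding K_def by (intro level_separation[OF s2[of 0] PQ(1,2) _ _ nc])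
    then show ?thesis unfolding good_def by (metis fst_conv snd_conv)
  qed
  moreover have "\<exists>T'. good (Suc n) T' \<and> (fst T \<subseteq> fst T' \<and> snd T \<subseteq> snd T')" if "good n T" for n T
  proof -
    have K: "K n \<subseteq> K (Suc n)" using s by (auto simp: K_def field_simps intro: order_trans[of _ "2 * h _"] dest: h_nonneg)
    have T: "closed (fst T)" "closed (snd T)" "fst T \<union> snd T = K n" "fst T \<inter> snd T = {}" "P \<subseteq> fst T" "Q \<subseteq> snd T"
      using that unfolding good_def by auto
    have KL: "K n \<subseteq> L" by (auto simp: K_def)
    have ct: "compact (fst T)" "compact (snd T)"
      using T KL compact_L by (metis Un_subset_iff compact_Int_closed inf.absorb_iff2)+
    \<comment> \<open>The two pieces are disjoint, closed and cover \<open>K n\<close>, and a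
      connected part of a segment within \<open>K n\<close> cannot meet both. So they may themselves
      be separated one level lower.\<close>
    have nc': "p \<notin> A q \<and> q \<notin> A p" if pq: "p \<in> fst T" "q \<in> snd T" for p q
    proof (rule ccontr)
      assume "\<not> ?thesis"
      moreover have "p \<in> L" "q \<in> L" using pq T KL by auto
      ultimately obtain z where z: "z \<in> L" "p \<in> A z" "q \<in> A z" using A_self by blast
      define C where "C = {w \<in> A z. s / 2 ^ n \<le> h w}"
      have "connected C" using A_connected_upper z s2[of n] by (simp add: C_def)
      moreover have "C \<subseteq> K n" using A_subset z by (auto simp: C_def K_def)
      ultimately have "fst T \<inter> C = {} \<or> snd T \<inter> C = {}"
        using T by (intro connected_closedD) auto
      moreover have "p \<in> C" "q \<in> C" using z pq T by (auto simp: C_def K_def)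
      ultimately show False using pq by auto
    qed
    have "fst T \<subseteq> K (Suc n)" "snd T \<subseteq> K (Suc n)" using T K by auto
    then have "\<exists>T1 T2. closed T1 \<and> closed T2 \<and> T1 \<union> T2 = K (Suc n) \<and> T1 \<inter> T2 = {} \<and> fst T \<subseteq> T1 \<and> snd T \<subseteq> T2"
      unfolding K_def by (intro level_separation[OF s2[of "Suc n"] ct _ _ nc'])
    then obtain T1 T2 where "closed T1" "closed T2" "T1 \<union> T2 = K (Suc n)" "T1 \<inter> T2 = {}" "fst T \<subseteq> T1" "snd T \<subseteq> T2"
      by auto
    then have "good (Suc n) (T1, T2)" using T unfolding good_def by auto
    then show ?thesis using \<open>fst T \<subseteq> T1\<close> \<open>snd T \<subseteq> T2\<close> by (metis fst_conv snd_conv)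
  qed
  ultimately obtain T where T: "\<And>n. good n (T n)" and inc: "\<And>n. fst (T n) \<subseteq> fst (T (Suc n)) \<and> snd (T n) \<subseteq> snd (T (Suc n))"
    using dependent_nat_choice[of good "\<lambda>_ T T'. fst T \<subseteq> fst T' \<and> snd T \<subseteq> snd T'"] by metis
  have mono: "fst (T m) \<subseteq> fst (T n) \<and> snd (T m) \<subseteq> snd (T n)" if "m \<le> n" for m n
    using that inc by (induction rule: dec_induct) blast+
  have Tn: "closed (fst (T n))" "closed (snd (T n))" "fst (T n) \<union> snd (T n) = K n" "fst (T n) \<inter> snd (T n) = {}"
    for n using T[of n] unfolding good_def by auto
  define U W where "U = (\<Union>n. fst (T n))" and "W = (\<Union>n. snd (T n))"
  have deep: "\<exists>n. s / 2 ^ n < h x" if "x \<in> L" "x \<noteq> v" for x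
  proof -
    obtain n where "s / h x < 2 ^ n" using real_arch_pow[of 2 "s / h x"] by auto
    then show ?thesis using h_pos[OF that] by (auto simp: field_simps)
  qed
  have UW: "U \<union> W = L - {v}"
  proof
    have "K n \<subseteq> L - {v}" for n using s2[of n] h_v by (auto simp: K_def)
    then have "fst (T n) \<subseteq> L - {v}" "snd (T n) \<subseteq> L - {v}" for n using Tn(3)[of n] by blast+
    then show "U \<union> W \<subseteq> L - {v}" unfolding U_def W_def by (intro Un_least UN_least)
    show "L - {v} \<subseteq> U \<union> W"
    proof
      fix x assume "x \<in> L - {v}"
      then obtain n where "s / 2 ^ n < h x" using deep by blast
      then have "x \<in> K n" using \<open>x \<in> L - {v}\<close> by (simp add: K_def)
      then show "x \<in> U \<union> W" using Tn(3)[of n] unfolding U_def W_def by blast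
    qed
  qed
  have disj: "U \<inter> W = {}"
  proof -
    have "fst (T m) \<inter> snd (T n) = {}" for m n
      using mono[of m "max m n"] mono[of n "max m n"] Tn(4)[of "max m n"] by auto
    then show ?thesis unfolding U_def W_def by blast
  qed
  \<comment> \<open>Later stages add nothing above level \<open>n\<close>, since \<open>T n\<close>
    already splits all of \<open>K n\<close>.\<close>
  have level: "U \<inter> K n \<subseteq> fst (T n)" "W \<inter> K n \<subseteq> snd (T n)" for n
    using Tn(3)[of n] disj unfolding U_def W_def by blast+
  \<comment> \<open>A limit other than the top has height above some \<open>s / 2 ^ n\<close>, so
    the sequence finally stays in the closed set \<open>F n\<close>.\<close>
  have closed_insert: "closed (insert v Z)"
    if Z: "Z \<subseteq> L" "\<And>n. Z \<inter> K n \<subseteq> F n" "\<And>n. closed (F n)" "\<And>n. F n \<subseteq> Z" for Z F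
    unfolding closed_sequential_limits
  proof (intro allI impI)
    fix xs x assume xs: "(\<forall>n. xs n \<in> insert v Z) \<and> xs \<longlonglongrightarrow> x"
    then have xs': "\<And>n. xs n \<in> insert v Z" "xs \<longlonglongrightarrow> x" by auto
    then have L: "xs n \<in> L" for n using Z(1) v_in by (metis insertE subsetD)
    then have "x \<in> L" using closed_sequentially[OF closed_L _ xs'(2)] by auto
    show "x \<in> insert v Z"
    proof (cases "x = v")
      case False
      then obtain n where n: "s / 2 ^ n < h x" using deep \<open>x \<in> L\<close> by blast
      have "\<forall>\<^sub>F k in sequentially. s / 2 ^ n < h (xs k)"
        using order_tendstoD(1)[OF h_seq[OF L xs'(2)] n] .
      then have "\<forall>\<^sub>F k in sequentially. xs k \<in> F n"
      proof eventually_elim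
        case (elim k)
        have "xs k \<noteq> v" using elim s2[of n] h_v by auto
        then show ?case using xs'(1)[of k] L[of k] elim Z(2)[of n] by (auto simp: K_def)
      qed
      then have "x \<in> F n" using Lim_in_closed_set[OF Z(3) _ _ xs'(2)] by auto
      then show ?thesis using Z(4)[of n] by blast
    qed simp
  qed
  have "closed (insert v U)"
    by (rule closed_insert[of U "\<lambda>n. fst (T n)"]) (use UW level Tn U_def in auto)
  moreover have "closed (insert v W)"
    by (rule closed_insert[of W "\<lambda>n. snd (T n)"]) (use UW level Tn W_def in auto)
  moreover have "L - U = insert v W" using UW disj v_in by auto
  ultimately have "sector U" using UW unfolding sector_def by auto
  moreover have "P \<subseteq> U" "Q \<subseteq> W" using T[of 0] unfolding good_def U_def W_def by auto
  ultimately show thesis using that disj by blast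
qed

text \<open>The segment of \<open>e\<close> is separated from all points not close to it. Maximality
  makes this possible: a point comparable to the upper part of the segment lies on the segment
  itself.\<close>

lemma sector_at_maximal:
  assumes e: "maximal e" and "0 < \<epsilon>" "0 < \<eta>"
  obtains U where "sector U" "e \<in> U" "small \<epsilon> U" "\<And>x. x \<in> U \<Longrightarrow> h x < h e + \<eta>"
proof -
  have eL: "e \<in> L" "e \<noteq> v" using e by (auto simp: maximal_def)
  obtain s1 where s1: "0 < s1" "\<And>x. \<lbrakk>x \<in> L; h x \<le> s1\<rbrakk> \<Longrightarrow> dist x v < \<epsilon> / 2"
    using near_v[of "\<epsilon> / 2"] \<open>0 < \<epsilon>\<close> by auto
  \<comment> \<open>Up to height \<open>s\<close> all points are within
    \<open>\<epsilon> / 2\<close> of the top; the bound \<open>h e\<close> keeps \<open>e\<close> in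
    \<open>P\<close>.\<close>
  define s where "s = min s1 (h e)"
  have s: "0 < s" "s \<le> h e" "s \<le> s1" using s1 h_pos[OF eL] by (auto simp: s_def)
  obtain \<delta> where \<delta>: "0 < \<delta>" "\<And>x y. \<lbrakk>x \<in> L; y \<in> A x; h x - h y \<le> \<delta>\<rbrakk> \<Longrightarrow> dist x y < \<epsilon> / 2"
    using seg_short[of "\<epsilon> / 2"] \<open>0 < \<epsilon>\<close> by auto
  have "uniformly_continuous_on L h" using h_cont compact_L by (rule compact_uniformly_continuous)
  moreover have "0 < min \<eta> (\<delta> / 2)" using assms \<delta> by simp
  ultimately obtain \<zeta>0 where \<zeta>0: "0 < \<zeta>0" "\<And>x y. \<lbrakk>x \<in> L; y \<in> L; dist y x < \<zeta>0\<rbrakk> \<Longrightarrow> dist (h y) (h x) < min \<eta> (\<delta> / 2)"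
    unfolding uniformly_continuous_on_def by metis
  \<comment> \<open>Two points of equal height are replaced by points of \<open>P\<close> at cost
    \<open>\<epsilon> / 4\<close> each. The heights change by less than \<open>\<delta> / 2\<close>
    each, so the replacements are within \<open>\<epsilon> / 2\<close> of each other.\<close>
  define \<zeta> where "\<zeta> = min \<zeta>0 (\<epsilon> / 4)"
  have \<zeta>: "0 < \<zeta>" "\<zeta> \<le> \<epsilon> / 4" using \<zeta>0 assms by (auto simp: \<zeta>_def)
  have h_near: "\<bar>h x - h y\<bar> < \<eta>" "\<bar>h x - h y\<bar> < \<delta> / 2" if "x \<in> L" "y \<in> L" "dist x y < \<zeta>" for x y
    using \<zeta>0(2)[of y x] that by (auto simp: \<zeta>_def dist_real_def)
  define K where "K = {x \<in> L. s \<le> h x}"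
  define P where "P = {y \<in> A e. s \<le> h y}"
  define Q where "Q = K - (\<Union>a\<in>P. ball a \<zeta>)"
  have PL: "P \<subseteq> L" using A_subset eL by (auto simp: P_def)
  have PK: "P \<subseteq> K" using PL by (auto simp: P_def K_def)
  have "K \<subseteq> L - {v}" using s h_v by (auto simp: K_def)
  have "closed K"
    using continuous_closed_preimage[OF h_cont closed_L, of "{s..}"] by (simp add: K_def vimage_def Int_def)
  then have "compact K" using compact_L \<open>K \<subseteq> L - {v}\<close> by (metis Diff_subset compact_Int_closed inf.absorb_iff2 order_trans)
  then have "compact Q" unfolding Q_def by (intro compact_diff) auto
  moreover have "compact P" using A_connected_upper(2)[OF eL(1), of s] s by (simp add: P_def)
  moreover have "p \<notin> A q \<and> q \<notin> A p" if pq: "p \<in> P" "q \<in> Q" for p q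
  proof (rule ccontr)
    assume "\<not> ?thesis"
    then have c: "q \<in> A p \<or> p \<in> A q" by blast
    have p: "p \<in> L" "p \<noteq> v" "p \<in> A e" using pq PK \<open>K \<subseteq> L - {v}\<close> by (auto simp: P_def)
    have q: "q \<in> L" "q \<in> K" using pq \<open>K \<subseteq> L - {v}\<close> by (auto simp: Q_def)
    have "q \<in> A e \<or> e \<in> A q" using comparable_trans[OF q(1) p(1) eL(1) p(2) c] p(3) by blast
    then have "q \<in> A e" using e q A_self by (auto simp: maximal_def)
    then have "q \<in> P" using q by (auto simp: P_def K_def)
    then show False using pq \<zeta> by (force simp: Q_def)
  qed
  moreover have "P \<subseteq> L - {v}" "Q \<subseteq> L - {v}" using PK \<open>K \<subseteq> L - {v}\<close> by (auto simp: Q_def)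
  ultimately obtain U where U: "sector U" "P \<subseteq> U" "Q \<inter> U = {}"
    using sector_separation[of P Q] by metis
  have near: "\<exists>a\<in>P. dist x a < \<zeta>" if "x \<in> U" "s \<le> h x" for x
  proof -
    have "x \<in> K" using that sector_subset[OF U(1)] by (auto simp: K_def)
    then have "x \<in> (\<Union>a\<in>P. ball a \<zeta>)" using that U by (auto simp: Q_def)
    then show ?thesis by (auto simp: dist_commute)
  qed
  show thesis
  proof (rule that)
    show "sector U" by fact
    show "e \<in> U" using U A_self[OF eL(1)] s by (auto simp: P_def)
    show "h x < h e + \<eta>" if x: "x \<in> U" for x
    proof (cases "s \<le> h x")
      case True
      then obtain a where a: "a \<in> P" "dist x a < \<zeta>" using near x by blast
      have "h a \<le> h e" using a h_mono[OF eL(1)] by (auto simp: P_def)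
      then show ?thesis using h_near(1)[of x a] a PL x sector_subset(1)[OF U(1) x] by auto
    next
      case False then show ?thesis using s \<open>0 < \<eta>\<close> by auto
    qed
    show "small \<epsilon> U"
      unfolding small_def
    proof (intro ballI impI)
      fix x y assume xy: "x \<in> U" "y \<in> U" "h x = h y"
      have L: "x \<in> L" "y \<in> L" using xy sector_subset(1)[OF U(1)] by auto
      show "dist x y \<le> \<epsilon>"
      proof (cases "s \<le> h x")
        case True
        then obtain a b where ab: "a \<in> P" "dist x a < \<zeta>" "b \<in> P" "dist y b < \<zeta>"
          using near xy by metis
        have abL: "a \<in> L" "b \<in> L" using ab PL by auto
        have "\<bar>h x - h a\<bar> < \<delta> / 2" "\<bar>h y - h b\<bar> < \<delta> / 2"
          using h_near(2) L abL ab by auto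
        then have "h a - h b \<le> \<delta>" "h b - h a \<le> \<delta>" using xy by linarith+
        moreover have "a \<in> A b \<or> b \<in> A a" using A_linear[OF eL(1)] ab by (simp add: P_def)
        ultimately have "dist a b < \<epsilon> / 2" using \<delta>(2)[of a b] \<delta>(2)[of b a] abL by (auto simp: dist_commute)
        then show ?thesis using ab \<zeta> dist_triangle[of x y a] dist_triangle[of a y b] dist_commute[of y b] by linarith
      next
        case False
        then have "dist x v < \<epsilon> / 2" "dist y v < \<epsilon> / 2" using s1(2) L xy s by auto
        then show ?thesis using dist_triangle2[of x y v] by linarith
      qed
    qed
  qed
qed

section \<open>Finite partitions into small sectors\<close>

lemma maximal_above:
  assumes "x \<in> L" "x \<noteq> v" obtains e where "maximal e" "x \<in> A e"
proof -
  define Z where "Z = {y \<in> L. x \<in> A y}"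
  have "closed Z"
    unfolding closed_sequential_limits
  proof (intro allI impI)
    fix ys y assume ys: "(\<forall>n. ys n \<in> Z) \<and> ys \<longlonglongrightarrow> y"
    then have "y \<in> L" using closed_sequentially[OF closed_L, of ys y] by (auto simp: Z_def)
    moreover have "x \<in> A y" using A_closed[of ys "\<lambda>_. x" y x] ys by (auto simp: Z_def)
    ultimately show "y \<in> Z" by (simp add: Z_def)
  qed
  moreover have ZL: "Z \<subseteq> L" by (auto simp: Z_def)
  ultimately have "compact Z" using compact_L by (metis compact_Int_closed inf.absorb_iff2)
  moreover have "x \<in> Z" using assms A_self by (simp add: Z_def)
  moreover have "continuous_on Z h" using h_cont ZL continuous_on_subset by blast
  ultimately obtain e where e: "e \<in> Z" "\<And>y. y \<in> Z \<Longrightarrow> h y \<le> h e"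
    using continuous_attains_sup[of Z h] by auto
  have "maximal e"
    unfolding maximal_def
  proof (intro conjI ballI impI)
    show "e \<in> L" using e by (simp add: Z_def)
    show "e \<noteq> v" using e h_v h_pos[OF assms] \<open>x \<in> Z\<close> by force
    fix y assume y: "y \<in> L" "e \<in> A y"
    then have "y \<in> Z" using A_trans[OF y] e by (auto simp: Z_def)
    then show "y = e" using e(2) h_strict[OF y] by force
  qed
  then show thesis using that e by (simp add: Z_def)
qed

lemma disjointify_sectors:
  assumes "finite \<C>" "\<And>U. U \<in> \<C> \<Longrightarrow> sector U \<and> small \<epsilon> U"
  shows "\<exists>\<P>. finite \<P> \<and> (\<forall>U\<in>\<P>. sector U \<and> small \<epsilon> U) \<and> disjoint \<P> \<and> \<Union>\<P> = \<Union>\<C>"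
  using assms
proof (induction rule: finite_induct)
  case empty
  show ?case by (intro exI[of _ "{}"]) auto
next
  case (insert U \<C>)
  then obtain \<P> where P: "finite \<P>" "\<forall>U\<in>\<P>. sector U \<and> small \<epsilon> U" "disjoint \<P>" "\<Union>\<P> = \<Union>\<C>" by auto
  have "sector (U - \<Union>\<P>)" "small \<epsilon> (U - \<Union>\<P>)"
    using insert.prems[of U] P sector_Union[of \<P>] sector_Diff small_subset[of \<epsilon> U] by auto
  then show ?case
    using P by (intro exI[of _ "insert (U - \<Union>\<P>) \<P>"]) (auto simp: disjoint_def)
qed

text \<open>Compactness covers the points above a small height by finitely many small sectors. What
  remains are short legs near the top, which form one more small sector.\<close>

lemma sector_partition:
  assumes W: "sector W" and "0 < \<epsilon>"
  obtains \<P> where "finite \<P>" "\<And>U. U \<in> \<P> \<Longrightarrow> sector U \<and> U \<noteq> {} \<and> small \<epsilon> U" "disjoint \<P>" "\<Union>\<P> = W"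
proof -
  obtain s where s: "0 < s" "\<And>x. \<lbrakk>x \<in> L; h x \<le> s\<rbrakk> \<Longrightarrow> dist x v < \<epsilon> / 2"
    using near_v[of "\<epsilon> / 2"] \<open>0 < \<epsilon>\<close> by auto
  define K where "K = {x \<in> L. s \<le> h x}"
  have "closed K"
    using continuous_closed_preimage[OF h_cont closed_L, of "{s..}"] by (simp add: K_def vimage_def Int_def)
  moreover have KL: "K \<subseteq> L - {v}" using s h_v by (auto simp: K_def)
  ultimately have "compact K" using compact_L by (metis Diff_subset compact_Int_closed inf.absorb_iff2 order_trans)
  have "\<exists>U. sector U \<and> small \<epsilon> U \<and> x \<in> U" if "x \<in> K" for x
  proof -
    have x: "x \<in> L" "x \<noteq> v" using that KL by auto
    obtain e where e: "maximal e" "x \<in> A e" using maximal_above[OF x] .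
    obtain U where "sector U" "e \<in> U" "small \<epsilon> U"
      using sector_at_maximal[OF e(1) \<open>0 < \<epsilon>\<close> zero_less_one] by metis
    then show ?thesis using sector_saturated[of U e x] x e(2) by blast
  qed
  then obtain N where N: "\<And>x. x \<in> K \<Longrightarrow> sector (N x) \<and> small \<epsilon> (N x) \<and> x \<in> N x" by metis
  \<comment> \<open>The set \<open>- (L - N x)\<close> is open in the whole space and agrees with
    \<open>N x\<close> inside \<open>L\<close>.\<close>
  obtain F where F: "F \<subseteq> K" "finite F" "K \<subseteq> (\<Union>x\<in>F. - (L - N x))"
  proof (rule compactE_image[OF \<open>compact K\<close>, of K "\<lambda>x. - (L - N x)"])
    show "open (- (L - N x))" if "x \<in> K" for x using N[OF that] unfolding sector_def by blast
    show "K \<subseteq> (\<Union>x\<in>K. - (L - N x))" using N by blast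
  qed
  define R where "R = L - {v} - \<Union>(N ` F)"
  have cov: "K \<subseteq> \<Union>(N ` F)" using F KL by blast
  have "sector (\<Union>(N ` F))" using F N by (intro sector_Union) auto
  then have "sector R" unfolding R_def by (rule sector_compl)
  moreover have "small \<epsilon> R"
    unfolding small_def
  proof (intro ballI impI)
    fix x y assume "x \<in> R" "y \<in> R" "h x = h y"
    then have "x \<in> L" "y \<in> L" "h x \<le> s" "h y \<le> s" using cov by (auto simp: R_def K_def)
    then have "dist x v < \<epsilon> / 2" "dist y v < \<epsilon> / 2" using s(2) by auto
    then show "dist x y \<le> \<epsilon>" using dist_triangle2[of x y v] by linarith
  qed
  ultimately have "\<exists>\<P>. finite \<P> \<and> (\<forall>U\<in>\<P>. sector U \<and> small \<epsilon> U) \<and> disjoint \<P> \<and> \<Union>\<P> = \<Union>(insert R (N ` F))"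
    using F N by (intro disjointify_sectors) auto
  then obtain \<P> where P: "finite \<P>" "\<And>U. U \<in> \<P> \<Longrightarrow> sector U \<and> small \<epsilon> U" "disjoint \<P>" "\<Union>\<P> = \<Union>(insert R (N ` F))"
    by auto
  have sup: "W \<subseteq> \<Union>\<P>" using W unfolding P(4) R_def sector_def by auto
  show thesis
  proof (rule that[of "(\<lambda>U. U \<inter> W) ` \<P> - {{}}"])
    show "sector U \<and> U \<noteq> {} \<and> small \<epsilon> U" if "U \<in> (\<lambda>U. U \<inter> W) ` \<P> - {{}}" for U
      using that P(2) W by (auto intro: sector_Int small_subset)
    show "disjoint ((\<lambda>U. U \<inter> W) ` \<P> - {{}})"
      using P(3) unfolding disjoint_def by blast
    show "\<Union>((\<lambda>U. U \<inter> W) ` \<P> - {{}}) = W" using sup by blast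
  qed (use P in auto)
qed

section \<open>End points and sectors of prescribed height\<close>

lemma separate_maximal:
  assumes "finite E" "\<And>e. e \<in> E \<Longrightarrow> maximal e"
  shows "\<exists>W. (\<forall>e\<in>E. sector (W e) \<and> e \<in> W e) \<and> disjoint_family_on W E"
  using assms
proof (induction rule: finite_induct)
  case empty
  show ?case by (auto simp: disjoint_family_on_def)
next
  case (insert e E)
  then obtain W where W: "\<forall>e\<in>E. sector (W e) \<and> e \<in> W e" "disjoint_family_on W E" by auto
  have m: "maximal x" if "x \<in> insert e E" for x using insert that by blast
  obtain S where S: "sector S" "{e} \<subseteq> S" "E \<inter> S = {}"
  proof (rule sector_separation[of "{e}" E])
    show "compact E" using insert by (simp add: finite_imp_compact)
    show "{e} \<subseteq> L - {v}" "E \<subseteq> L - {v}" using m by (auto simp: maximal_def)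
    show "p \<notin> A q \<and> q \<notin> A p" if "p \<in> {e}" "q \<in> E" for p q
      using that m[of p] m[of q] insert.hyps unfolding maximal_def by auto
  qed auto
  define W' where "W' x = (if x = e then S else W x - S)" for x
  have "sector (W' x) \<and> x \<in> W' x" if "x \<in> insert e E" for x
    using that S W insert.hyps by (auto simp: W'_def sector_Diff)
  moreover have "disjoint_family_on W' (insert e E)"
    using W(2) unfolding disjoint_family_on_def W'_def by auto
  ultimately show ?case by blast
qed

text \<open>The longest leg of \<open>V\<close> passes through every positive height up to
  \<open>M V\<close>, and end points accumulate at each of its points. If only finitely many were
  suitable, a point of the leg at a height different from all of theirs would have a neighbourhood
  avoiding them.\<close>

lemma infinite_maximal_near_height:
  assumes V: "sector V" "V \<noteq> {}" and \<tau>: "0 < \<tau>" "\<tau> \<le> M V" and "0 < \<zeta>"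
  shows "infinite {e. maximal e \<and> e \<in> V \<and> \<bar>h e - \<tau>\<bar> < \<zeta>}" (is "infinite ?E")
proof
  assume fin: "finite ?E"
  have "max 0 (\<tau> - \<zeta>) < \<tau>" using assms by simp
  then have "infinite ({max 0 (\<tau> - \<zeta>)<..<\<tau>} - h ` ?E)" using fin by (simp add: infinite_Ioo)
  then obtain t where t: "max 0 (\<tau> - \<zeta>) < t" "t < \<tau>" "t \<notin> h ` ?E"
    by (metis (lifting) DiffE all_not_in_conv finite.emptyI greaterThanLessThan_iff)
  define w where "w = pt (tip V) t"
  have w: "w \<in> V" "h w = t" using pt_tip[OF V, of t] t \<tau> by (auto simp: w_def)
  have wL: "w \<in> L" "w \<noteq> v" using sector_subset[OF V(1) w(1)] by auto
  define G where "G = - (L - V) - ?E"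
  have "w \<notin> ?E" using t(3) w(2) by blast
  then have "w \<in> G" using w by (simp add: G_def)
  moreover have "open G"
  proof -
    have "closed (L - V)" using V(1) unfolding sector_def by blast
    then show ?thesis unfolding G_def using open_Diff[OF open_Compl finite_imp_closed[OF fin]] by blast
  qed
  ultimately obtain d1 where d1: "0 < d1" "ball w d1 \<subseteq> G" by (meson openE)
  have "0 < min (t - (\<tau> - \<zeta>)) (\<tau> - t)" using t by simp
  then obtain d2 where d2: "0 < d2" "\<And>x. \<lbrakk>x \<in> L; dist x w < d2\<rbrakk> \<Longrightarrow> dist (h x) (h w) < min (t - (\<tau> - \<zeta>)) (\<tau> - t)"
    using h_cont[unfolded continuous_on_iff] wL(1) by meson
  obtain e where e: "e \<in> L" "e \<noteq> v" "dist e w < min d1 d2" "maximal e"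
    using ends_dense[OF wL, of "min d1 d2"] d1(1) d2(1) unfolding maximal_def by auto
  have "e \<in> G" using d1 e by (auto simp: dist_commute)
  then have "e \<in> V" "e \<notin> ?E" using e by (auto simp: G_def)
  moreover have "\<bar>h e - \<tau>\<bar> < \<zeta>" using d2(2)[of e] e w t by (simp add: dist_real_def abs_less_iff)
  ultimately show False using e by simp
qed

lemma disjoint_subsectors:
  fixes \<tau> \<zeta> :: "'i \<Rightarrow> real"
  assumes V: "sector V" "V \<noteq> {}" and "finite I" "0 < \<epsilon>"
    and \<tau>: "\<And>i. i \<in> I \<Longrightarrow> 0 < \<tau> i \<and> \<tau> i \<le> M V" and \<zeta>: "\<And>i. i \<in> I \<Longrightarrow> 0 < \<zeta> i"
  shows "\<exists>W. (\<forall>i\<in>I. sector (W i) \<and> W i \<noteq> {} \<and> W i \<subseteq> V \<and> small \<epsilon> (W i) \<and> \<bar>M (W i) - \<tau> i\<bar> < \<zeta> i)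
    \<and> disjoint_family_on W I"
proof -
  have "infinite {e. maximal e \<and> e \<in> V \<and> \<bar>h e - \<tau> i\<bar> < \<zeta> i / 2}" if "i \<in> I" for i
    using infinite_maximal_near_height[OF V, of "\<tau> i" "\<zeta> i / 2"] \<tau>[OF that] \<zeta>[OF that] by auto
  then obtain e where e: "inj_on e I" "\<And>i. i \<in> I \<Longrightarrow> maximal (e i) \<and> e i \<in> V \<and> \<bar>h (e i) - \<tau> i\<bar> < \<zeta> i / 2"
    using injective_choice[OF \<open>finite I\<close>, of "\<lambda>i. {e. maximal e \<and> e \<in> V \<and> \<bar>h e - \<tau> i\<bar> < \<zeta> i / 2}"] by auto
  obtain S where S: "\<And>i. i \<in> I \<Longrightarrow> sector (S (e i)) \<and> e i \<in> S (e i)" "disjoint_family_on S (e ` I)"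
  proof -
    have "maximal x" if "x \<in> e ` I" for x using e(2) that by blast
    then show ?thesis using separate_maximal[of "e ` I"] \<open>finite I\<close> that by auto
  qed
  have "\<exists>U. sector U \<and> e i \<in> U \<and> small \<epsilon> U \<and> (\<forall>x\<in>U. h x < h (e i) + \<zeta> i / 2)" if "i \<in> I" for i
    using sector_at_maximal[of "e i" \<epsilon> "\<zeta> i / 2"] e(2)[OF that] \<zeta>[OF that] \<open>0 < \<epsilon>\<close> by (metis half_gt_zero)
  then obtain N where N: "\<And>i. i \<in> I \<Longrightarrow> sector (N i) \<and> e i \<in> N i \<and> small \<epsilon> (N i) \<and> (\<forall>x\<in>N i. h x < h (e i) + \<zeta> i / 2)"
    by metis
  \<comment> \<open>\<open>S\<close> gives disjointness, \<open>N\<close> smallness and the upper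
    bound. Half of \<open>\<zeta> i\<close> pays for the choice of the end point, the other half for
    the sector around it.\<close>
  define W where "W i = V \<inter> S (e i) \<inter> N i" for i
  have "sector (W i) \<and> W i \<noteq> {} \<and> W i \<subseteq> V \<and> small \<epsilon> (W i) \<and> \<bar>M (W i) - \<tau> i\<bar> < \<zeta> i" if i: "i \<in> I" for i
  proof -
    have s: "sector (W i)" using V S(1)[OF i] N[OF i] by (auto simp: W_def intro: sector_Int)
    have ei: "e i \<in> W i" using e(2)[OF i] S(1)[OF i] N[OF i] by (auto simp: W_def)
    then have ne: "W i \<noteq> {}" by auto
    have "h (e i) \<le> M (W i)" using M_ge[OF s ne ei] .
    moreover have "M (W i) < h (e i) + \<zeta> i / 2" using tip_in[OF s ne] N[OF i] by (auto simp: W_def)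
    ultimately have "\<bar>M (W i) - \<tau> i\<bar> < \<zeta> i" using e(2)[OF i] by linarith
    moreover have "small \<epsilon> (W i)" using N[OF i] by (auto simp: W_def intro: small_subset)
    ultimately show ?thesis using s ne by (auto simp: W_def)
  qed
  moreover have "disjoint_family_on W I"
    using S(2) e(1) unfolding disjoint_family_on_def W_def inj_on_def by blast
  ultimately show ?thesis by blast
qed

subsection \<open>Matching sectors\<close>

definition rate :: "'a set \<Rightarrow> 'a set \<Rightarrow> real" where "rate U V = M V / M U"

definition linked :: "real \<Rightarrow> 'a set \<times> 'a set \<Rightarrow> bool" where
  "linked \<epsilon> p \<longleftrightarrow> sector (fst p) \<and> fst p \<noteq> {} \<and> small \<epsilon> (fst p) \<and> sector (snd p) \<and> snd p \<noteq> {} \<and> small \<epsilon> (snd p)"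

text \<open>Closeness of two ratios does not control their reciprocals, and the maps in the two
  directions use one each.\<close>

definition refines :: "real \<Rightarrow> 'a set \<times> 'a set \<Rightarrow> 'a set \<times> 'a set \<Rightarrow> bool" where
  "refines \<delta> p p' \<longleftrightarrow> fst p' \<subseteq> fst p \<and> snd p' \<subseteq> snd p
    \<and> \<bar>rate (fst p') (snd p') - rate (fst p) (snd p)\<bar> \<le> \<delta>
    \<and> \<bar>rate (snd p') (fst p') - rate (snd p) (fst p)\<bar> \<le> \<delta>"

definition separated :: "('a set \<times> 'a set) set \<Rightarrow> bool" where
  "separated R \<longleftrightarrow> (\<forall>p\<in>R. \<forall>p'\<in>R. p \<noteq> p' \<longrightarrow> fst p \<inter> fst p' = {} \<and> snd p \<inter> snd p' = {})"

lemma separatedD: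
  "\<lbrakk>separated R; p \<in> R; p' \<in> R; x \<in> fst p; x \<in> fst p'\<rbrakk> \<Longrightarrow> p = p'"
  "\<lbrakk>separated R; p \<in> R; p' \<in> R; x \<in> snd p; x \<in> snd p'\<rbrakk> \<Longrightarrow> p = p'"
  unfolding separated_def by blast+

text \<open>The prescribed height \<open>\<alpha> * M U'\<close> never exceeds \<open>M V\<close>,
  since \<open>\<alpha>\<close> is the old ratio and \<open>M U' \<le> M U\<close>. Only
  \<open>U\<close> is exhausted; legs of \<open>V\<close> may be left over.\<close>

lemma refinement:
  assumes UV: "sector U" "U \<noteq> {}" "sector V" "V \<noteq> {}" and pos: "0 < \<epsilon>" "0 < \<delta>"
  shows "\<exists>R. finite R \<and> separated R \<and> \<Union>(fst ` R) = U \<and> (\<forall>p'\<in>R. linked \<epsilon> p' \<and> refines \<delta> (U, V) p')"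
proof -
  obtain \<P> where P: "finite \<P>" "\<And>U'. U' \<in> \<P> \<Longrightarrow> sector U' \<and> U' \<noteq> {} \<and> small \<epsilon> U'" "disjoint \<P>" "\<Union>\<P> = U"
    using sector_partition[OF UV(1) pos(1)] by metis
  define \<alpha> where "\<alpha> = rate U V"
  have M: "0 < M U" "0 < M V" using M_pos UV by auto
  then have \<alpha>: "0 < \<alpha>" by (simp add: \<alpha>_def rate_def)
  have MP: "0 < M U'" "M U' \<le> M U" if "U' \<in> \<P>" for U'
  proof -
    show "0 < M U'" using M_pos P(2)[OF that] by blast
    have "tip U' \<in> U" using tip_in[of U'] P(2)[OF that] P(4) that by blast
    then show "M U' \<le> M U" using M_ge UV by blast
  qed
  have "\<exists>\<zeta>>0. \<forall>m. \<bar>m - \<alpha> * M U'\<bar> < \<zeta> \<longrightarrow> \<bar>m / M U' - \<alpha>\<bar> \<le> \<delta> \<and> \<bar>M U' / m - 1 / \<alpha>\<bar> \<le> \<delta>"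
    if "U' \<in> \<P>" for U'
    using rate_continuity[OF \<alpha> MP(1)[OF that] pos(2)] .
  then obtain \<zeta> where \<zeta>: "\<And>U'. U' \<in> \<P> \<Longrightarrow> 0 < \<zeta> U'"
    "\<And>U' m. \<lbrakk>U' \<in> \<P>; \<bar>m - \<alpha> * M U'\<bar> < \<zeta> U'\<rbrakk> \<Longrightarrow> \<bar>m / M U' - \<alpha>\<bar> \<le> \<delta> \<and> \<bar>M U' / m - 1 / \<alpha>\<bar> \<le> \<delta>"
    by metis
  have "0 < \<alpha> * M U' \<and> \<alpha> * M U' \<le> M V" if "U' \<in> \<P>" for U'
  proof -
    have "\<alpha> * M U' \<le> \<alpha> * M U" using MP(2)[OF that] \<alpha> by simp
    also have "\<dots> = M V" using M by (simp add: \<alpha>_def rate_def)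
    finally show ?thesis using \<alpha> MP(1)[OF that] by simp
  qed
  then obtain W where W: "\<And>U'. U' \<in> \<P> \<Longrightarrow> sector (W U') \<and> W U' \<noteq> {} \<and> W U' \<subseteq> V \<and> small \<epsilon> (W U') \<and> \<bar>M (W U') - \<alpha> * M U'\<bar> < \<zeta> U'"
    "disjoint_family_on W \<P>"
    using disjoint_subsectors[OF UV(3,4) P(1) pos(1), of "\<lambda>U'. \<alpha> * M U'" \<zeta>] \<zeta>(1) by metis
  define R where "R = (\<lambda>U'. (U', W U')) ` \<P>"
  have "finite R" using P by (simp add: R_def)
  moreover have "separated R"
    using P(3) W(2) unfolding separated_def R_def disjoint_def disjoint_family_on_def by force
  moreover have "\<Union>(fst ` R) = U" using P(4) by (auto simp: R_def)
  moreover have "linked \<epsilon> p' \<and> refines \<delta> (U, V) p'" if "p' \<in> R" for p'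
  proof -
    obtain U' where U': "U' \<in> \<P>" "p' = (U', W U')" using \<open>p' \<in> R\<close> by (auto simp: R_def)
    have "\<bar>M (W U') / M U' - \<alpha>\<bar> \<le> \<delta> \<and> \<bar>M U' / M (W U') - 1 / \<alpha>\<bar> \<le> \<delta>"
      using \<zeta>(2)[OF U'(1)] W(1)[OF U'(1)] by blast
    moreover have "1 / \<alpha> = rate V U" by (simp add: \<alpha>_def rate_def)
    ultimately have "refines \<delta> (U, V) p'"
      using W(1)[OF U'(1)] U' P(4) by (auto simp: refines_def rate_def \<alpha>_def)
    then show ?thesis using U' P(2)[OF U'(1)] W(1)[OF U'(1)] by (simp add: linked_def)
  qed
  ultimately show ?thesis by blast
qed

section \<open>Rescaling maps and their gluing\<close>

definition move :: "'a set \<Rightarrow> 'a set \<Rightarrow> 'a \<Rightarrow> 'a" where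
  "move U V x = pt (tip V) (min (h x * rate U V) (M V))"

lemma move:
  \<comment> \<open>All of \<open>U\<close> lands on the longest leg of \<open>V\<close>. The
    minimum in \<open>move\<close> is inactive on \<open>U\<close>; it makes the map defined and
    continuous on the whole fan.\<close>
  assumes U: "sector U" "U \<noteq> {}" and V: "sector V" "V \<noteq> {}"
  shows continuous_on_move: "continuous_on L (move U V)"
    and move_v: "move U V v = v"
    and h_move: "x \<in> U \<Longrightarrow> h (move U V x) = h x * rate U V"
    and move_in: "x \<in> U \<Longrightarrow> move U V x \<in> V"
proof -
  have M: "0 < M U" "0 < M V" using M_pos U V by auto
  have r: "0 < rate U V" using M by (simp add: rate_def)
  have tL: "tip V \<in> L" using tip_in_L V by blast
  have "continuous_on L (\<lambda>x. min (h x * rate U V) (M V))" by (intro continuous_intros h_cont)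
  moreover have "(\<lambda>x. min (h x * rate U V) (M V)) ` L \<subseteq> {0..M V}" using h_nonneg r M by auto
  ultimately show "continuous_on L (move U V)"
    unfolding move_def by (rule continuous_on_compose2[OF continuous_on_pt[OF tL]])
  show "move U V v = v" using h_v M pt_0[OF tL] by (simp add: move_def)
  assume x: "x \<in> U"
  have "h x \<le> M U" "0 < h x" using M_ge U x sector_subset[OF U(1) x] h_pos by auto
  then have b: "h x * rate U V \<le> M V" "0 < h x * rate U V" using M by (auto simp: rate_def field_simps)
  then have "move U V x = pt (tip V) (h x * rate U V)" by (simp add: move_def)
  then show "h (move U V x) = h x * rate U V" "move U V x \<in> V"
    using pt_tip[OF V b(2,1)] by auto
qed

text \<open>Each sector together with the top is closed, and so is what the finitely many sectors
  leave over. On each member of this finite closed cover \<open>F\<close> is one of the given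
  maps.\<close>

lemma continuous_on_glue:
  assumes S: "finite S" "\<And>p. p \<in> S \<Longrightarrow> sector (D p)"
    and g: "\<And>p. p \<in> S \<Longrightarrow> continuous_on L (g p)" "\<And>p. p \<in> S \<Longrightarrow> g p v = v"
    and k: "continuous_on L k"
    and F: "F v = v" "\<And>p x. \<lbrakk>p \<in> S; x \<in> D p\<rbrakk> \<Longrightarrow> F x = g p x"
      "\<And>x. \<lbrakk>x \<in> L; \<And>p. p \<in> S \<Longrightarrow> x \<notin> D p\<rbrakk> \<Longrightarrow> F x = k x"
  shows "continuous_on L F"
proof -
  have sub: "insert v (D p) \<subseteq> L" if "p \<in> S" for p using S(2)[OF that] v_in by (auto simp: sector_def)
  have "continuous_on (\<Union>p\<in>S. insert v (D p)) F"
  proof (rule continuous_on_closed_Union[OF S(1)])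
    fix p assume p: "p \<in> S"
    show "closed (insert v (D p))" using S(2)[OF p] by (simp add: sector_def)
    have "continuous_on (insert v (D p)) (g p)" using g(1)[OF p] sub[OF p] by (rule continuous_on_subset)
    then show "continuous_on (insert v (D p)) F"
      by (rule continuous_on_eq) (use F g(2)[OF p] p in auto)
  qed
  moreover have "continuous_on (L - (\<Union>p\<in>S. D p)) F"
  proof (rule continuous_on_eq)
    show "continuous_on (L - (\<Union>p\<in>S. D p)) k" using k by (rule continuous_on_subset) auto
  qed (use F(3) in auto)
  moreover have "closed (\<Union>p\<in>S. insert v (D p))"
    using S(2) unfolding sector_def by (intro closed_UN[OF S(1)]) blast
  moreover have "closed (L - (\<Union>p\<in>S. D p))"
  proof -
    have "sector (\<Union>(D ` S))" using S by (intro sector_Union) auto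
    then show ?thesis by (simp add: sector_def)
  qed
  ultimately have "continuous_on ((\<Union>p\<in>S. insert v (D p)) \<union> (L - (\<Union>p\<in>S. D p))) F"
    by (intro continuous_on_closed_Un)
  then show ?thesis by (rule continuous_on_subset) auto
qed

lemma proper_sector:
  obtains V z where "sector V" "V \<noteq> {}" "z \<in> L" "z \<noteq> v" "z \<notin> V"
proof -
  have ne: "L - {v} \<noteq> {}" using nontrivial by blast
  have "infinite {e. maximal e \<and> e \<in> L - {v} \<and> \<bar>h e - M (L - {v})\<bar> < 1}"
    using infinite_maximal_near_height[OF sector_full ne, of "M (L - {v})" 1] M_pos[OF sector_full ne] by simp
  then have "infinite {e. maximal e}" by (rule infinite_super[rotated]) auto
  then obtain e1 where e1: "maximal e1" by (metis (lifting) finite.emptyI mem_Collect_eq equals0I)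
  have "infinite ({e. maximal e} - {e1})" using \<open>infinite {e. maximal e}\<close> by simp
  then obtain e2 where e2: "maximal e2" "e2 \<noteq> e1" by (metis (lifting) DiffE equals0I finite.emptyI insertI1 mem_Collect_eq)
  obtain W where W: "\<forall>e\<in>{e1, e2}. sector (W e) \<and> e \<in> W e" "disjoint_family_on W {e1, e2}"
    using separate_maximal[of "{e1, e2}"] e1 e2 by auto
  have "W e1 \<inter> W e2 = {}" using W(2) e2(2) unfolding disjoint_family_on_def by auto
  then show thesis using that[of "W e1" e2] W(1) e2(1) by (auto simp: maximal_def)
qed

section \<open>The sequence of matchings and its two limits\<close>

theorem proper_self_retract:
  obtains f q where "continuous_on L f" "f ` L \<subseteq> L" "continuous_on L q" "q ` L \<subseteq> L"
    "\<And>x. x \<in> L \<Longrightarrow> q (f x) = x" "f ` L \<noteq> L"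
proof -
  obtain V0 z where V0: "sector V0" "V0 \<noteq> {}" and z: "z \<in> L" "z \<noteq> v" "z \<notin> V0"
    using proper_sector by blast
  obtain b where b: "\<And>x. x \<in> L \<Longrightarrow> dist v x \<le> b"
    using compact_imp_bounded[OF compact_L] by (metis bounded_any_center)
  \<comment> \<open>\<open>B\<close> is positive and bounds all distances in \<open>L\<close>; as
    \<open>\<epsilon> 0 = B\<close>, the initial pair is linked automatically.\<close>
  define B where "B = 2 * \<bar>b\<bar> + 1"
  have B: "0 < B" "dist x y \<le> B" if "x \<in> L" "y \<in> L" for x y
    using b[OF that(1)] b[OF that(2)] dist_triangle3[of x y v] by (auto simp: B_def)
  have B0: "0 < B" using B v_in by blast
  define \<epsilon> where "\<epsilon> n = B / 2 ^ n" for n :: nat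
  have \<epsilon>: "0 < \<epsilon> n" for n using B0 by (simp add: \<epsilon>_def)
  have "\<exists>\<delta>>0. \<forall>U x y. sector U \<longrightarrow> small (\<epsilon> n) U \<longrightarrow> x \<in> U \<longrightarrow> y \<in> U \<longrightarrow> \<bar>h x - h y\<bar> \<le> \<delta> \<longrightarrow> dist x y \<le> 2 * \<epsilon> n" for n
    using small_dist[OF \<epsilon>[of n]] by metis
  then obtain \<delta> where \<delta>: "\<And>n. 0 < \<delta> n"
    "\<And>n U x y. \<lbrakk>sector U; small (\<epsilon> n) U; x \<in> U; y \<in> U; \<bar>h x - h y\<bar> \<le> \<delta> n\<rbrakk> \<Longrightarrow> dist x y \<le> 2 * \<epsilon> n"
    by metis
  \<comment> \<open>Fixing one refinement for every stage and pair turns the matchings into a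
    recursion.\<close>
  define R where "R n p = (SOME R. finite R \<and> separated R \<and> \<Union>(fst ` R) = fst p \<and>
     (\<forall>p'\<in>R. linked (\<epsilon> (Suc n)) p' \<and> refines (\<delta> n) p p'))" for n p
  have R: "finite (R n p)" "separated (R n p)" "\<Union>(fst ` R n p) = fst p"
      "p' \<in> R n p \<Longrightarrow> linked (\<epsilon> (Suc n)) p'" "p' \<in> R n p \<Longrightarrow> refines (\<delta> n) p p'"
    if "linked (\<epsilon> n) p" for n p p'
  proof -
    have "\<exists>R. finite R \<and> separated R \<and> \<Union>(fst ` R) = fst p \<and> (\<forall>p'\<in>R. linked (\<epsilon> (Suc n)) p' \<and> refines (\<delta> n) p p')"
      using refinement[of "fst p" "snd p", OF _ _ _ _ \<epsilon>[of "Suc n"] \<delta>(1)[of n]] that by (simp add: linked_def)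
    from someI_ex[OF this]
    show "finite (R n p)" "separated (R n p)" "\<Union>(fst ` R n p) = fst p"
      "p' \<in> R n p \<Longrightarrow> linked (\<epsilon> (Suc n)) p'" "p' \<in> R n p \<Longrightarrow> refines (\<delta> n) p p'"
      unfolding R_def[symmetric] by blast+
  qed
  define S where "S = rec_nat {(L - {v}, V0)} (\<lambda>n S. \<Union>p\<in>S. R n p)"
  have S0: "S 0 = {(L - {v}, V0)}" and SS: "S (Suc n) = (\<Union>p\<in>S n. R n p)" for n by (simp_all add: S_def)
  have inv: "finite (S n) \<and> separated (S n) \<and> \<Union>(fst ` S n) = L - {v} \<and> (\<forall>p\<in>S n. linked (\<epsilon> n) p \<and> snd p \<subseteq> V0)" for n
  proof (induction n)
    case 0
    have "small (\<epsilon> 0) U" if "U \<subseteq> L" for U using B(2) that by (auto simp: small_def \<epsilon>_def)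
    moreover have "V0 \<subseteq> L" using V0 by (auto simp: sector_def)
    ultimately show ?case using V0 sector_full z by (auto simp: S0 separated_def linked_def)
  next
    case (Suc n)
    then have IH: "finite (S n)" "separated (S n)" "\<Union>(fst ` S n) = L - {v}"
      and lk: "\<And>p. p \<in> S n \<Longrightarrow> linked (\<epsilon> n) p" and V: "\<And>p. p \<in> S n \<Longrightarrow> snd p \<subseteq> V0" by auto
    have sub: "fst p' \<subseteq> fst p" "snd p' \<subseteq> snd p" if "p \<in> S n" "p' \<in> R n p" for p p'
      using R(5)[OF lk[OF that(1)] that(2)] by (auto simp: refines_def)
    have "finite (S (Suc n))" using IH(1) R(1) lk by (simp add: SS)
    moreover have "separated (S (Suc n))"
      unfolding separated_def SS
    proof (intro ballI impI)
      fix p1' p2' assume "p1' \<in> (\<Union>p\<in>S n. R n p)" "p2' \<in> (\<Union>p\<in>S n. R n p)" and ne: "p1' \<noteq> p2'"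
      then obtain p1 p2 where p: "p1 \<in> S n" "p1' \<in> R n p1" "p2 \<in> S n" "p2' \<in> R n p2" by blast
      show "fst p1' \<inter> fst p2' = {} \<and> snd p1' \<inter> snd p2' = {}"
      proof (cases "p1 = p2")
        case True
        then show ?thesis using R(2)[OF lk[OF p(1)]] p ne unfolding separated_def by blast
      next
        case False
        then have "fst p1 \<inter> fst p2 = {} \<and> snd p1 \<inter> snd p2 = {}"
          using IH(2) p unfolding separated_def by blast
        then show ?thesis using sub[OF p(1,2)] sub[OF p(3,4)] by blast
      qed
    qed
    moreover have "\<Union>(fst ` S (Suc n)) = L - {v}"
    proof -
      have "\<Union>(fst ` S (Suc n)) = (\<Union>p\<in>S n. \<Union>(fst ` R n p))" unfolding SS by blast
      also have "\<dots> = (\<Union>p\<in>S n. fst p)" using R(3)[OF lk] by simp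
      finally show ?thesis using IH(3) by simp
    qed
    moreover have "linked (\<epsilon> (Suc n)) p' \<and> snd p' \<subseteq> V0" if p': "p' \<in> S (Suc n)" for p'
    proof -
      obtain p where p: "p \<in> S n" "p' \<in> R n p" using p' unfolding SS by blast
      show ?thesis using R(4)[OF lk[OF p(1)] p(2)] order_trans[OF sub(2)[OF p] V[OF p(1)]] by simp
    qed
    ultimately show ?case by blast
  qed
  then have fin: "finite (S n)" and sep: "separated (S n)" and cov: "\<Union>(fst ` S n) = L - {v}"
    and lk: "p \<in> S n \<Longrightarrow> linked (\<epsilon> n) p" and SV: "p \<in> S n \<Longrightarrow> snd p \<subseteq> V0" for n p by auto
  have parent: "\<exists>p\<in>S n. refines (\<delta> n) p p'" if p': "p' \<in> S (Suc n)" for n p'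
  proof -
    obtain p where p: "p \<in> S n" "p' \<in> R n p" using p' unfolding SS by blast
    then show ?thesis using R(5)[OF lk[OF p(1)] p(2)] by blast
  qed
  have lkD: "sector (fst p)" "fst p \<noteq> {}" "small (\<epsilon> n) (fst p)" "sector (snd p)" "snd p \<noteq> {}" "small (\<epsilon> n) (snd p)"
    if "p \<in> S n" for n p using lk[OF that] unfolding linked_def by auto
  \<comment> \<open>The default \<open>v\<close> takes effect only at the top and outside
    \<open>L\<close>, as the first sectors cover \<open>L - {v}\<close>.\<close>
  define F where "F n x = (if \<exists>p\<in>S n. x \<in> fst p then
      (let p = SOME p. p \<in> S n \<and> x \<in> fst p in move (fst p) (snd p) x) else v)" for n x
  define G where "G n k y = (if \<exists>p\<in>S n. y \<in> snd p then
      (let p = SOME p. p \<in> S n \<and> y \<in> snd p in move (snd p) (fst p) y) else k y)" for n y and k :: "'a \<Rightarrow> 'a"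
  \<comment> \<open>A point that is left behind by the matching at some stage keeps its last image.\<close>
  define Q where "Q = rec_nat (G 0 (\<lambda>_. v)) (\<lambda>n k. G (Suc n) k)"
  have Q0: "Q 0 = G 0 (\<lambda>_. v)" and QS: "Q (Suc n) = G (Suc n) (Q n)" for n by (simp_all add: Q_def)
  have F_in: "F n x = move (fst p) (snd p) x" if "p \<in> S n" "x \<in> fst p" for n p x
  proof -
    have "(SOME p. p \<in> S n \<and> x \<in> fst p) = p"
      using that separatedD(1)[OF sep] by (intro some_equality) blast+
    then show ?thesis using that by (auto simp: F_def)
  qed
  have G_in: "G n k y = move (snd p) (fst p) y" if "p \<in> S n" "y \<in> snd p" for n p y k
  proof -
    have "(SOME p. p \<in> S n \<and> y \<in> snd p) = p"
      using that separatedD(2)[OF sep] by (intro some_equality) blast+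
    then show ?thesis using that by (auto simp: G_def)
  qed
  have Q_in: "Q n y = move (snd p) (fst p) y" if "p \<in> S n" "y \<in> snd p" for n p y
    using that G_in by (cases n) (auto simp: Q0 QS)
  have F_v: "F n v = v" for n
    using sector_subset(2)[OF lkD(1)] unfolding F_def by metis
  have G_v: "G n k v = v" if "k v = v" for n k
    using sector_subset(2)[OF lkD(4)] that unfolding G_def by metis
  have Q_v: "Q n v = v" for n
    by (induction n) (simp_all add: Q0 QS G_v)
  have F_cont: "continuous_on L (F n)" for n
  proof (rule continuous_on_glue[OF fin[of n], where D = fst and g = "\<lambda>p. move (fst p) (snd p)" and k = "\<lambda>_. v"])
    show "F n x = v" if "x \<in> L" "\<And>p. p \<in> S n \<Longrightarrow> x \<notin> fst p" for x using that by (auto simp: F_def)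
  qed (use lkD move F_v F_in in auto)
  have G_cont: "continuous_on L (G n k)" if "continuous_on L k" "k v = v" for n k
  proof (rule continuous_on_glue[OF fin[of n], where D = snd and g = "\<lambda>p. move (snd p) (fst p)" and k = k])
    show "G n k x = k x" if "x \<in> L" "\<And>p. p \<in> S n \<Longrightarrow> x \<notin> snd p" for x using that by (auto simp: G_def)
  qed (use lkD move G_v G_in that in auto)
  have Q_cont: "continuous_on L (Q n)" for n
    by (induction n) (simp_all add: Q0 QS G_cont Q_v)
  have ex_fst: "\<exists>p\<in>S n. x \<in> fst p" if "x \<in> L" "x \<noteq> v" for n x
    using cov[of n] that by blast
  have F_V0: "F n x \<in> insert v V0" for n x
  proof (cases "\<exists>p\<in>S n. x \<in> fst p")
    case True
    then obtain p where p: "p \<in> S n" "x \<in> fst p" by blast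
    have "F n x \<in> snd p" using F_in[OF p] move_in[of "fst p" "snd p" x] lkD[OF p(1)] p by simp
    then show ?thesis using SV[OF p(1)] by blast
  qed (simp add: F_def)
  have F_L: "F n x \<in> L" for n x using F_V0[of n x] V0(1) v_in by (auto simp: sector_def)
  have G_L: "G n k y \<in> L" if "k y \<in> L" for n k y
  proof (cases "\<exists>p\<in>S n. y \<in> snd p")
    case True
    then obtain p where p: "p \<in> S n" "y \<in> snd p" by blast
    have "G n k y \<in> fst p" using G_in[OF p] move_in[of "snd p" "fst p" y] lkD[OF p(1)] p by simp
    then show ?thesis using sector_subset(1)[OF lkD(1)[OF p(1)]] by blast
  qed (use that in \<open>simp add: G_def\<close>)
  have Q_L: "Q n y \<in> L" for n y
    by (induction n) (simp_all add: Q0 QS G_L v_in)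
  \<comment> \<open>Both images lie in the second sector of the parent pair. Since heights are at
    most 1, the new ratio changes the height by at most \<open>\<delta> n\<close>.\<close>
  have F_step: "dist (F (Suc n) x) (F n x) \<le> (2 * B) / 2 ^ n" if x: "x \<in> L" for n x
  proof (cases "x = v")
    case False
    then obtain p' where p': "p' \<in> S (Suc n)" "x \<in> fst p'" using ex_fst x by blast
    then obtain p where p: "p \<in> S n" "refines (\<delta> n) p p'" using parent by blast
    then have xp: "x \<in> fst p" "snd p' \<subseteq> snd p" using p' by (auto simp: refines_def)
    have 1: "F (Suc n) x \<in> snd p" "h (F (Suc n) x) = h x * rate (fst p') (snd p')"
      using F_in[OF p'] move_in[of "fst p'" "snd p'" x] h_move[of "fst p'" "snd p'" x] lkD[OF p'(1)] p' xp by auto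
    have 2: "F n x \<in> snd p" "h (F n x) = h x * rate (fst p) (snd p)"
      using F_in[OF p(1) xp(1)] move_in[of "fst p" "snd p" x] h_move[of "fst p" "snd p" x] lkD[OF p(1)] xp by auto
    have "\<bar>h (F (Suc n) x) - h (F n x)\<bar> = h x * \<bar>rate (fst p') (snd p') - rate (fst p) (snd p)\<bar>"
      unfolding 1 2 using h_nonneg[OF x] by (simp add: abs_mult flip: right_diff_distrib)
    also have "\<dots> \<le> 1 * \<delta> n"
      using h_nonneg[OF x] h_le[OF x] p(2) by (intro mult_mono) (auto simp: refines_def)
    finally have "dist (F (Suc n) x) (F n x) \<le> 2 * \<epsilon> n"
      using \<delta>(2)[OF lkD(4,6)[OF p(1)] 1(1) 2(1)] by simp
    then show ?thesis by (simp add: \<epsilon>_def)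
  qed (use F_v B0 in simp)
  \<comment> \<open>A point matched at stage \<open>n + 1\<close> was matched at stage
    \<open>n\<close> by the parent pair; at any other point \<open>Q\<close> does not
    change.\<close>
  have Q_step: "dist (Q (Suc n) y) (Q n y) \<le> (2 * B) / 2 ^ n" if y: "y \<in> L" for n y
  proof (cases "\<exists>p'\<in>S (Suc n). y \<in> snd p'")
    case True
    then obtain p' where p': "p' \<in> S (Suc n)" "y \<in> snd p'" by blast
    then obtain p where p: "p \<in> S n" "refines (\<delta> n) p p'" using parent by blast
    then have yp: "y \<in> snd p" "fst p' \<subseteq> fst p" using p' by (auto simp: refines_def)
    have 1: "Q (Suc n) y \<in> fst p" "h (Q (Suc n) y) = h y * rate (snd p') (fst p')"
      using Q_in[OF p'] move_in[of "snd p'" "fst p'" y] h_move[of "snd p'" "fst p'" y] lkD[OF p'(1)] p' yp by auto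
    have 2: "Q n y \<in> fst p" "h (Q n y) = h y * rate (snd p) (fst p)"
      using Q_in[OF p(1) yp(1)] move_in[of "snd p" "fst p" y] h_move[of "snd p" "fst p" y] lkD[OF p(1)] yp by auto
    have "\<bar>h (Q (Suc n) y) - h (Q n y)\<bar> = h y * \<bar>rate (snd p') (fst p') - rate (snd p) (fst p)\<bar>"
      unfolding 1 2 using h_nonneg[OF y] by (simp add: abs_mult flip: right_diff_distrib)
    also have "\<dots> \<le> 1 * \<delta> n"
      using h_nonneg[OF y] h_le[OF y] p(2) by (intro mult_mono) (auto simp: refines_def)
    finally have "dist (Q (Suc n) y) (Q n y) \<le> 2 * \<epsilon> n"
      using \<delta>(2)[OF lkD(1,3)[OF p(1)] 1(1) 2(1)] by simp
    then show ?thesis by (simp add: \<epsilon>_def)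
  next
    case False
    then have "Q (Suc n) y = Q n y" by (simp add: QS G_def)
    then show ?thesis using B0 by simp
  qed
  obtain f where f: "continuous_on L f" "\<And>x. x \<in> L \<Longrightarrow> f x \<in> L"
      "\<And>n x. x \<in> L \<Longrightarrow> dist (F n x) (f x) \<le> 2 * (2 * B) / 2 ^ n"
    using geometric_uniform_limit[OF compact_L F_cont F_L F_step] by metis
  obtain q where q: "continuous_on L q" "\<And>x. x \<in> L \<Longrightarrow> q x \<in> L"
      "\<And>n x. x \<in> L \<Longrightarrow> dist (Q n x) (q x) \<le> 2 * (2 * B) / 2 ^ n"
    using geometric_uniform_limit[OF compact_L Q_cont Q_L Q_step] by metis
  \<comment> \<open>The two ratios are reciprocal, so the composite returns to the sector and to the
    height of \<open>x\<close>. It need not return to \<open>x\<close>, because \<open>move\<close>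
    forgets the leg.\<close>
  have QF: "dist (Q n (F n x)) x \<le> B / 2 ^ n" if x: "x \<in> L" for n x
  proof (cases "x = v")
    case False
    then obtain p where p: "p \<in> S n" "x \<in> fst p" using ex_fst x by blast
    have 1: "F n x \<in> snd p" "h (F n x) = h x * rate (fst p) (snd p)"
      using F_in[OF p] move_in[of "fst p" "snd p" x] h_move[of "fst p" "snd p" x] lkD[OF p(1)] p by auto
    have 2: "Q n (F n x) \<in> fst p" "h (Q n (F n x)) = h (F n x) * rate (snd p) (fst p)"
      using Q_in[OF p(1) 1(1)] move_in[of "snd p" "fst p" "F n x"] h_move[of "snd p" "fst p" "F n x"] lkD[OF p(1)] 1 by auto
    have "h (Q n (F n x)) = h x"
      using 1 2 M_pos[of "fst p"] M_pos[of "snd p"] lkD[OF p(1)] by (simp add: rate_def)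
    then show ?thesis using lkD(3)[OF p(1)] 2(1) p(2) by (simp add: small_def \<epsilon>_def)
  qed (use F_v Q_v B0 in simp)
  have geo: "(\<lambda>n. c / 2 ^ n) \<longlonglongrightarrow> 0" for c :: real by (rule LIMSEQ_divide_realpow_zero) simp
  have f_lim: "(\<lambda>n. F n x) \<longlonglongrightarrow> f x" if "x \<in> L" for x
    using f(3)[OF that] by (intro metric_tendsto_imp_tendsto[OF geo[of "2 * (2 * B)"]]) (simp add: B0 less_imp_le)
  have qf: "q (f x) = x" if x: "x \<in> L" for x
  proof (rule LIMSEQ_unique)
    show "(\<lambda>n. q (F n x)) \<longlonglongrightarrow> q (f x)"
      using continuous_on_tendsto_compose[OF q(1) f_lim[OF x] f(2)[OF x]] F_L by simp
    \<comment> \<open>The limit \<open>q\<close> contributes an error of \<open>4 * B\<close>, and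
      \<open>QF\<close> contributes \<open>B\<close>.\<close>
    have "dist (q (F n x)) x \<le> (5 * B) / 2 ^ n" for n
    proof -
      have "dist (q (F n x)) x \<le> dist (Q n (F n x)) (q (F n x)) + dist (Q n (F n x)) x"
        by (metis dist_commute dist_triangle)
      also have "\<dots> \<le> 2 * (2 * B) / 2 ^ n + B / 2 ^ n"
        by (rule add_mono[OF q(3)[OF F_L] QF[OF x]])
      finally show ?thesis by (simp add: add_divide_distrib[symmetric])
    qed
    then show "(\<lambda>n. q (F n x)) \<longlonglongrightarrow> x"
      by (intro metric_tendsto_imp_tendsto[OF geo[of "5 * B"]]) (simp add: B0 less_imp_le)
  qed
  have "f x \<noteq> z" if "x \<in> L" for x
  proof -
    have "closed (insert v V0)" using V0 by (simp add: sector_def)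
    then have "f x \<in> insert v V0" using closed_sequentially[of "insert v V0" "\<lambda>n. F n x" "f x"] F_V0 f_lim[OF that] by simp
    then show ?thesis using z by auto
  qed
  then have "f ` L \<noteq> L" using z(1) by (metis imageE)
  then show thesis using that[of f q] f(1,2) q(1,2) qf by (simp add: image_subsetI)
qed

end

section \<open>Lelek fans\<close>

lemma radial_fan_of_Lelek_fan:
  fixes L :: "'a::metric_space set"
  assumes "Lelek_fan L"
  obtains v A h where "radial_fan L v A h"
proof -
  have "smooth_fan L" and dense: "closure (end_points L) = L" using assms by (auto simp: Lelek_fan_def)
  then obtain v where v: "fan L" "ramification_point L v"
    and sm: "\<forall>x xs A B. x \<in> L \<and> (\<forall>n. xs n \<in> L) \<and> xs \<longlonglongrightarrow> x \<and>
            (\<forall>n. arc_from_to L v (xs n) (A n)) \<and> arc_from_to L v x B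
            \<longrightarrow> (\<lambda>n. hausdist (A n) B) \<longlonglongrightarrow> 0"
    unfolding smooth_fan_def by blast
  interpret smooth_fan_at L v
    by unfold_locales (use v sm in blast)+
  obtain h :: "'a \<Rightarrow> real" where h: "continuous_on L h" "h v = 0" "\<And>x. x \<in> L \<Longrightarrow> h x \<le> 1"
    "\<And>x y. \<lbrakk>x \<in> L; y \<in> A x; y \<noteq> x\<rbrakk> \<Longrightarrow> h y < h x"
    using height_exists by metis
  have "radial_fan L v A h"
  proof
    show "\<exists>x\<in>L. x \<noteq> v"
    proof -
      obtain g where "arc g" "pathstart g = v" "path_image g \<subseteq> L"
        using v(2) unfolding ramification_point_def by blast
      then show ?thesis using arc_distinct_ends[of g] pathfinish_in_path_image[of g] by (metis subsetD)
    qed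
    show "\<exists>e\<in>L. e \<noteq> v \<and> dist e x < \<epsilon> \<and> (\<forall>y\<in>L. e \<in> A y \<longrightarrow> y = e)"
      if x: "x \<in> L" "x \<noteq> v" and "0 < \<epsilon>" for x \<epsilon>
    proof -
      \<comment> \<open>Staying closer to \<open>x\<close> than \<open>v\<close> is keeps the end
        point away from the top.\<close>
      have "0 < min \<epsilon> (dist v x)" using x \<open>0 < \<epsilon>\<close> by simp
      then obtain e where e: "e \<in> end_points L" "dist e x < min \<epsilon> (dist v x)"
        using x(1) dense closure_approachable[of x "end_points L"] by blast
      then have "e \<noteq> v" by auto
      then show ?thesis using e end_point_maximal[OF e(1)] by (auto simp: end_points_def intro!: bexI[of _ e])
    qed
  qed (fact compact_L v_in A_subset A_self A_v A_trans A_connected A_linear A_fork A_closed h no_loop)+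
  then show thesis by (rule that)
qed

theorem mainTheorem5:
  fixes L :: "'a::metric_space set"
  assumes "Lelek_fan L"
  shows "(\<exists>f. embedding_into L L f \<and> f ` L \<noteq> L \<and> (\<exists>r. retraction L (f ` L) r))
       \<and> (\<exists>f. embedding_into L L f \<and> \<not> (\<exists>r. retraction L (f ` L) r))"
proof
  obtain v A h where "radial_fan L v A h" using radial_fan_of_Lelek_fan[OF assms] .
  then interpret radial_fan L v A h .
  show "\<exists>f. embedding_into L L f \<and> f ` L \<noteq> L \<and> (\<exists>r. retraction L (f ` L) r)"
  proof -
    obtain f q where f: "continuous_on L f" "f ` L \<subseteq> L" and q: "continuous_on L q" "q ` L \<subseteq> L"
      and qf: "\<And>x. x \<in> L \<Longrightarrow> q (f x) = x" and ne: "f ` L \<noteq> L"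
      using proper_self_retract by blast
    have "homeomorphism L (f ` L) f q"
      using f q qf continuous_on_subset[OF q(1) f(2)] by (intro homeomorphismI) auto
    then have "embedding_into L L f" using f(2) by (auto simp: embedding_into_def)
    moreover have "retraction L (f ` L) (f \<circ> q)"
      unfolding retraction_def
    proof (intro conjI)
      show "continuous_on L (f \<circ> q)" using q continuous_on_subset[OF f(1) q(2)] by (intro continuous_on_compose)
    qed (use f q qf in auto)
    ultimately show ?thesis using ne by blast
  qed
  have "\<exists>g. homeomorphism L (half ` L) half g"
    using homeomorphism_compact[OF compact_L continuous_on_half refl inj_on_half] by metis
  then have "embedding_into L L half" using half(3) by (auto simp: embedding_into_def)
  then show "\<exists>f. embedding_into L L f \<and> \<not> (\<exists>r. retraction L (f ` L) r)"
    using half_no_retraction by blast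
qed

end
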